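(* Let $n\ge 1$, $m\ge 1$ and $d\ge 0$ be integers, and let $r(z,\bar z)$ be a real-valued bihomogeneous polynomial of bidegree $(m,m)$ on $\mathbb{C}^n\times\mathbb{C}^n$ with signature pair $(P,N)$ and rank $R=P+N$. Suppose that $r(z,\bar z)\|z\|^{2d}$ is a squared norm. Put $H(m)=D_m-R$. Then $$P\ \ge\ \frac{D_{m+d}-\big[\cdots\big[\,[H(m)^{<m>}]^{<m+1>}\,\big]\cdots\big]^{<m+d-1>}}{D_d},$$ where the operations $c\mapsto c^{<m>},\ c\mapsto c^{<m+1>},\ \dots,\ c\mapsto c^{<m+d-1>}$ are applied successively to $H(m)$. If the $m$-th Macaulay representation of $D_m-R$ is $\sum_{j=J}^m\binom{k_j}{j}$, this inequality is equivalent to $$P\ \ge\ \frac{D_{m+d}-\sum_{j=J}^m\binom{k_j+d}{j+d}}{D_d}.$$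
   Context: For an integer $k\ge 0$, $D_k=\binom{k+n-1}{k}$ is the dimension of the space of homogeneous polynomials of degree $k$ in $z_1,\dots,z_n$ over $\mathbb{C}$. A real-valued bihomogeneous polynomial of bidegree $(m,m)$ is $r(z,\bar z)=\sum_{|\alpha|=|\beta|=m}c_{\alpha\beta}z^\alpha\bar z^\beta$ with $(c_{\alpha\beta})$ a Hermitian matrix. Its signature pair $(P,N)$ consists of the numbers of positive and negative eigenvalues of $(c_{\alpha\beta})$, and its rank is $R=P+N$. Equivalently, $r=\sum_{j=1}^P|f_j(z)|^2-\sum_{k=1}^N|g_k(z)|^2$ with the $f_j,g_k$ holomorphic homogeneous polynomials of degree $m$ that are together linearly independent. A bihomogeneous polynomial is a squared norm if it equals $\|h(z)\|^2=\sum_{k=1}^K|h_k(z)|^2$ for some holomorphic polynomial mapping $h=(h_1,\dots,h_K):\mathbb{C}^n\to\mathbb{C}^K$. Here $\|z\|^2=\sum_{i=1}^n|z_i|^2$. For positive integers $c$ and $s$, the $s$-th Macaulay representation of $c$ is the unique expression $c=\binom{k_s}{s}+\binom{k_{s-1}}{s-1}+\cdots+\binom{k_J}{J}$ with $k_s>k_{s-1}>\cdots>k_J\ge J>0$, and $c^{<s>}=\binom{k_s+1}{s+1}+\binom{k_{s-1}+1}{s}+\cdots+\binom{k_J+1}{J+1}$. Conventions: $0^{<s>}=0$, and the Macaulay representation of $0$ is the empty sum. When $d=0$, no operation is applied to $H(m)$. *)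

theory Defs
  imports Complex_Main "Jordan_Normal_Form.Char_Poly" "Jordan_Normal_Form.Conjugate"
begin

section \<open>Bihomogeneous polynomials\<close>

text \<open>Points of \<open>\<complex>\<^sup>n\<close> are complex vectors in \<open>carrier_vec n\<close>; a multi-index
  in \<open>n\<close> variables is a list of naturals of length \<open>n\<close>.\<close>

definition D :: "nat \<Rightarrow> nat \<Rightarrow> nat" where
  "D n k = (k + n - 1) choose k"

text \<open>The list fixes an order in which the coefficient matrix is written down; the spectrum
  does not depend on that order.\<close>

definition multi_indices :: "nat \<Rightarrow> nat \<Rightarrow> nat list list" where
  "multi_indices n k = filter (\<lambda>\<alpha>. sum_list \<alpha> = k) (List.n_lists n [0..<Suc k])"

lemma set_multi_indices: "set (multi_indices n k) = {\<alpha>. length \<alpha> = n \<and> sum_list \<alpha> = k}"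
  using member_le_sum_list by (fastforce simp: multi_indices_def set_n_lists less_Suc_eq_le)

lemma distinct_multi_indices: "distinct (multi_indices n k)"
  by (simp add: multi_indices_def distinct_n_lists)

lemma length_multi_indices:
  assumes "n \<ge> 1"
  shows "length (multi_indices n k) = D n k"
  using card_length_sum_list[of n k] distinct_card[OF distinct_multi_indices[of n k]]
  by (simp add: set_multi_indices D_def)

definition monomial_eval :: "complex vec \<Rightarrow> nat list \<Rightarrow> complex" where
  "monomial_eval z \<alpha> = (\<Prod>i<length \<alpha>. (z $ i) ^ (\<alpha> ! i))"

text \<open>A bihomogeneous polynomial of bidegree \<open>(m,m)\<close> is given by its coefficient family \<open>c\<close>;
  only the values of \<open>c\<close> at pairs of multi-indices of degree \<open>m\<close> matter. It is a function on
  \<open>\<complex>\<^sup>n \<times> \<complex>\<^sup>n\<close>, and \<open>r(z, z-bar)\<close> is \<open>bihom_poly n m c z (conjugate z)\<close>.\<close>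

definition bihom_poly ::
    "nat \<Rightarrow> nat \<Rightarrow> (nat list \<Rightarrow> nat list \<Rightarrow> complex) \<Rightarrow> complex vec \<Rightarrow> complex vec \<Rightarrow> complex" where
  "bihom_poly n m c z w =
     (\<Sum>\<alpha>\<in>set (multi_indices n m). \<Sum>\<beta>\<in>set (multi_indices n m).
        c \<alpha> \<beta> * monomial_eval z \<alpha> * monomial_eval w \<beta>)"

definition hermitian_coeffs :: "nat \<Rightarrow> nat \<Rightarrow> (nat list \<Rightarrow> nat list \<Rightarrow> complex) \<Rightarrow> bool" where
  "hermitian_coeffs n m c \<longleftrightarrow>
     (\<forall>\<alpha>\<in>set (multi_indices n m). \<forall>\<beta>\<in>set (multi_indices n m). c \<beta> \<alpha> = cnj (c \<alpha> \<beta>))"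

definition coeff_mat :: "nat \<Rightarrow> nat \<Rightarrow> (nat list \<Rightarrow> nat list \<Rightarrow> complex) \<Rightarrow> complex mat" where
  "coeff_mat n m c =
     (let ms = multi_indices n m
      in mat (length ms) (length ms) (\<lambda>(i, j). c (ms ! i) (ms ! j)))"

text \<open>Eigenvalues are counted with multiplicity (as roots of the characteristic polynomial).
  The eigenvalues of a Hermitian matrix are real, so that summing over real numbers
  loses nothing.\<close>

definition num_pos_eigenvalues :: "complex mat \<Rightarrow> nat" where
  "num_pos_eigenvalues A =
     (\<Sum>x\<in>{x::real. x > 0 \<and> eigenvalue A (complex_of_real x)}.
        Polynomial.order (complex_of_real x) (char_poly A))"

definition num_neg_eigenvalues :: "complex mat \<Rightarrow> nat" where
  "num_neg_eigenvalues A =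
     (\<Sum>x\<in>{x::real. x < 0 \<and> eigenvalue A (complex_of_real x)}.
        Polynomial.order (complex_of_real x) (char_poly A))"

definition signature_pair ::
    "nat \<Rightarrow> nat \<Rightarrow> (nat list \<Rightarrow> nat list \<Rightarrow> complex) \<Rightarrow> nat \<times> nat" where
  "signature_pair n m c =
     (num_pos_eigenvalues (coeff_mat n m c), num_neg_eigenvalues (coeff_mat n m c))"


section \<open>Squared norms\<close>

definition sq_norm_cvec :: "nat \<Rightarrow> complex vec \<Rightarrow> real" where
  "sq_norm_cvec n z = (\<Sum>i<n. (cmod (z $ i))\<^sup>2)"

definition holomorphic_polynomial :: "nat \<Rightarrow> (complex vec \<Rightarrow> complex) \<Rightarrow> bool" where
  "holomorphic_polynomial n f \<longleftrightarrow>
     (\<exists>A a. finite A \<and> A \<subseteq> {\<alpha>. length \<alpha> = n} \<and>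
        (\<forall>z\<in>carrier_vec n. f z = (\<Sum>\<alpha>\<in>A. a \<alpha> * monomial_eval z \<alpha>)))"

definition is_squared_norm :: "nat \<Rightarrow> (complex vec \<Rightarrow> complex) \<Rightarrow> bool" where
  "is_squared_norm n F \<longleftrightarrow>
     (\<exists>(K::nat) (h :: nat \<Rightarrow> complex vec \<Rightarrow> complex).
        (\<forall>k<K. holomorphic_polynomial n (h k)) \<and>
        (\<forall>z\<in>carrier_vec n. F z = complex_of_real (\<Sum>k<K. (cmod (h k z))\<^sup>2)))"


section \<open>Macaulay representations\<close>

text \<open>\<open>macaulay_rep s c J k\<close>: the sum of \<open>k j choose j\<close> over \<open>j = J, \<dots>, s\<close> is the \<open>s\<close>-th Macaulay
  representation of \<open>c\<close>. The value \<open>J = s + 1\<close> stands for the empty sum; it occurs exactly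
  for \<open>c = 0\<close>.\<close>

definition macaulay_rep :: "nat \<Rightarrow> nat \<Rightarrow> nat \<Rightarrow> (nat \<Rightarrow> nat) \<Rightarrow> bool" where
  "macaulay_rep s c J k \<longleftrightarrow>
     0 < J \<and> J \<le> Suc s \<and> strict_mono_on {J..s} k \<and> (J \<le> s \<longrightarrow> J \<le> k J) \<and>
     c = (\<Sum>j=J..s. k j choose j)"

lemma macaulay_rep_ge:
  assumes "macaulay_rep s c J k" "J \<le> j" "j \<le> s"
  shows "j \<le> k j"
  using assms(2,3)
proof (induction j rule: dec_induct)
  case base
  then show ?case using assms by (simp add: macaulay_rep_def)
next
  case (step i)
  have "k i < k (Suc i)"
    using assms(1) step by (auto simp: macaulay_rep_def strict_mono_on_def)
  then show ?case using step by simp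
qed

lemma macaulay_rep_pred:
  assumes "macaulay_rep (Suc s) c J k" "J \<le> Suc s"
  shows "macaulay_rep s (c - (k (Suc s) choose Suc s)) J k"
    "c = (c - (k (Suc s) choose Suc s)) + (k (Suc s) choose Suc s)"
proof -
  have c: "c = (\<Sum>j=J..s. k j choose j) + (k (Suc s) choose Suc s)"
    using assms by (simp add: macaulay_rep_def)
  then show "c = (c - (k (Suc s) choose Suc s)) + (k (Suc s) choose Suc s)" by simp
  show "macaulay_rep s (c - (k (Suc s) choose Suc s)) J k"
    using assms c by (auto simp: macaulay_rep_def strict_mono_on_def)
qed

lemma macaulay_rep_zero_iff:
  assumes "macaulay_rep s c J k"
  shows "c = 0 \<longleftrightarrow> J = Suc s"
proof (cases "J \<le> s")
  case True
  have "s \<le> k s" using macaulay_rep_ge[OF assms True] by simp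
  then have "0 < k s choose s" by (rule zero_less_binomial)
  also have "\<dots> \<le> (\<Sum>j=J..s. k j choose j)"
    by (rule member_le_sum) (use True in simp_all)
  also have "\<dots> = c"
    using assms unfolding macaulay_rep_def by metis
  finally have "0 < c" .
  then show ?thesis using True by linarith
next
  case False
  then have "J = Suc s" "c = 0" using assms by (simp_all add: macaulay_rep_def)
  then show ?thesis by simp
qed

lemma macaulay_rep_less:
  assumes "macaulay_rep s c J k" "J \<le> s"
  shows "c < Suc (k s) choose s"
  using assms
proof (induction s arbitrary: c)
  case 0
  then show ?case by (simp add: macaulay_rep_def)
next
  case (Suc s)
  define c' where "c' = c - (k (Suc s) choose Suc s)"
  have c': "macaulay_rep s c' J k" "c = c' + (k (Suc s) choose Suc s)"
    using macaulay_rep_pred[OF Suc.prems] by (simp_all add: c'_def)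
  have ge: "Suc s \<le> k (Suc s)" using macaulay_rep_ge[OF Suc.prems(1)] Suc.prems(2) by simp
  have "c' < k (Suc s) choose s"
  proof (cases "J \<le> s")
    case True
    have "k s < k (Suc s)"
      using Suc.prems True by (auto simp: macaulay_rep_def strict_mono_on_def)
    then have "Suc (k s) choose s \<le> k (Suc s) choose s" by (intro binomial_right_mono) simp
    then show ?thesis using Suc.IH[OF c'(1) True] by simp
  next
    case False
    then have "c' = 0" using macaulay_rep_zero_iff[OF c'(1)] Suc.prems by simp
    then show ?thesis using ge by (simp add: zero_less_binomial_iff)
  qed
  then show ?case using c'(2) by simp
qed

lemma macaulay_rep_unique:
  assumes "macaulay_rep s c J k" "macaulay_rep s c J' k'"
  shows "J = J' \<and> (\<forall>j\<in>{J..s}. k j = k' j)"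
  using assms
proof (induction s arbitrary: c)
  case 0
  then show ?case by (auto simp: macaulay_rep_def)
next
  case (Suc s)
  show ?case
  proof (cases "c = 0")
    case True
    then have "J = Suc (Suc s)" "J' = Suc (Suc s)"
      using macaulay_rep_zero_iff[OF Suc.prems(1)] macaulay_rep_zero_iff[OF Suc.prems(2)] by simp_all
    then show ?thesis by simp
  next
    case False
    moreover have "J \<le> Suc (Suc s)" "J' \<le> Suc (Suc s)"
      using Suc.prems unfolding macaulay_rep_def by blast+
    ultimately have J: "J \<le> Suc s" "J' \<le> Suc s"
      using macaulay_rep_zero_iff[OF Suc.prems(1)] macaulay_rep_zero_iff[OF Suc.prems(2)]
      by linarith+
    note p = macaulay_rep_pred[OF Suc.prems(1) J(1)] macaulay_rep_pred[OF Suc.prems(2) J(2)]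
    have "\<not> k (Suc s) < k' (Suc s)"
    proof
      assume "k (Suc s) < k' (Suc s)"
      then have "Suc (k (Suc s)) choose Suc s \<le> k' (Suc s) choose Suc s"
        by (intro binomial_right_mono) simp
      then show False using macaulay_rep_less[OF Suc.prems(1) J(1)] p(4) by linarith
    qed
    moreover have "\<not> k' (Suc s) < k (Suc s)"
    proof
      assume "k' (Suc s) < k (Suc s)"
      then have "Suc (k' (Suc s)) choose Suc s \<le> k (Suc s) choose Suc s"
        by (intro binomial_right_mono) simp
      then show False using macaulay_rep_less[OF Suc.prems(2) J(2)] p(2) by linarith
    qed
    ultimately have eq: "k (Suc s) = k' (Suc s)" by simp
    have IH: "J = J' \<and> (\<forall>j\<in>{J..s}. k j = k' j)"
      by (rule Suc.IH[OF p(1) p(3)[folded eq]])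
    moreover have "k j = k' j" if "j \<in> {J..Suc s}" for j
      using IH eq that by (cases "j = Suc s") simp_all
    ultimately show ?thesis by blast
  qed
qed

lemma Suc_le_choose: "Suc c \<le> Suc (c + s) choose Suc s"
proof (induction c)
  case (Suc c)
  have "0 < Suc (c + s) choose s" by (rule zero_less_binomial) simp
  moreover have "Suc (Suc c + s) choose Suc s = (Suc (c + s) choose s) + (Suc (c + s) choose Suc s)"
    by simp
  ultimately show ?case using Suc by linarith
qed simp

lemma macaulay_rep_exists:
  assumes "s \<ge> 1"
  shows "\<exists>J k. macaulay_rep s c J k"
  using assms
proof (induction s arbitrary: c rule: nat_induct_at_least)
  case base
  have "macaulay_rep 1 c (if c = 0 then 2 else 1) (\<lambda>_. c)"
    by (auto simp: macaulay_rep_def strict_mono_on_def)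
  then show ?case by blast
next
  case (Suc s)
  show ?case
  proof (cases "c = 0")
    case True
    then have "macaulay_rep (Suc s) c (Suc (Suc s)) id"
      by (auto simp: macaulay_rep_def strict_mono_on_def)
    then show ?thesis by blast
  next
    case False
    have bd: "K \<le> c + s" if "K choose Suc s \<le> c" for K
    proof (rule ccontr)
      assume "\<not> K \<le> c + s"
      then have "Suc (c + s) choose Suc s \<le> K choose Suc s"
        by (intro binomial_right_mono) simp
      then show False using that Suc_le_choose[of c s] by simp
    qed
    define K where "K = (GREATEST K. K choose Suc s \<le> c)"
    have K: "K choose Suc s \<le> c"
      unfolding K_def by (rule GreatestI_nat[where k = 0 and b = "c + s"]) (use bd in auto)
    have K1: "\<not> Suc K choose Suc s \<le> c"
    proof
      assume "Suc K choose Suc s \<le> c"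
      then have "Suc K \<le> K" unfolding K_def by (rule Greatest_le_nat[where b = "c + s"]) (use bd in auto)
      then show False by simp
    qed
    have Ks: "Suc s \<le> K"
    proof (rule ccontr)
      assume "\<not> Suc s \<le> K"
      then have "Suc K choose Suc s \<le> Suc s choose Suc s" by (intro binomial_right_mono) simp
      then show False using K1 False by simp
    qed
    define c' where "c' = c - (K choose Suc s)"
    have c'l: "c' < K choose s" and c: "c = c' + (K choose Suc s)"
      using K K1 by (auto simp: c'_def)
    obtain J k where r: "macaulay_rep s c' J k" using Suc.IH by blast
    have lt: "k s < K" if "J \<le> s"
    proof (rule ccontr)
      assume "\<not> k s < K"
      then have "K choose s \<le> k s choose s" by (intro binomial_right_mono) simp
      also have "\<dots> \<le> (\<Sum>j=J..s. k j choose j)"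
        using that by (intro member_le_sum) auto
      also have "\<dots> = c'"
        using r by (simp add: macaulay_rep_def)
      finally show False using c'l by simp
    qed
    let ?k = "k(Suc s := K)"
    have JS: "J \<le> Suc s" "0 < J" using r by (auto simp: macaulay_rep_def)
    have "strict_mono_on {J..Suc s} ?k"
    proof (rule strict_mono_onI)
      fix i j assume ij: "i \<in> {J..Suc s}" "j \<in> {J..Suc s}" "i < j"
      have sm: "strict_mono_on {J..s} k" using r by (simp add: macaulay_rep_def)
      show "?k i < ?k j"
      proof (cases "j = Suc s")
        case True
        have "k i \<le> k s"
        proof (cases "i = s")
          case False
          then have "k i < k s" using ij True by (intro strict_mono_onD[OF sm]) auto
          then show ?thesis by simp
        qed simp
        then show ?thesis using True ij lt by auto
      next
        case False
        then show ?thesis using ij strict_mono_onD[OF sm, of i j] by auto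
      qed
    qed
    moreover have "c = (\<Sum>j=J..Suc s. ?k j choose j)"
      using c r JS by (simp add: macaulay_rep_def)
    moreover have "J \<le> ?k J"
      using r Ks by (cases "J \<le> s") (auto simp: macaulay_rep_def)
    ultimately have "macaulay_rep (Suc s) c J ?k" using JS by (simp add: macaulay_rep_def)
    then show ?thesis by blast
  qed
qed

definition macaulay_op :: "nat \<Rightarrow> nat \<Rightarrow> nat" where
  "macaulay_op s c =
     (THE v. \<exists>J k. macaulay_rep s c J k \<and> v = (\<Sum>j=J..s. (k j + 1) choose (j + 1)))"

lemma macaulay_op_eq:
  assumes "macaulay_rep s c J k"
  shows "macaulay_op s c = (\<Sum>j=J..s. (k j + 1) choose (j + 1))"
  unfolding macaulay_op_def
proof (rule the_equality)
  fix v assume "\<exists>J k. macaulay_rep s c J k \<and> v = (\<Sum>j=J..s. (k j + 1) choose (j + 1))"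
  then obtain J' k' where r: "macaulay_rep s c J' k'"
    and v: "v = (\<Sum>j=J'..s. (k' j + 1) choose (j + 1))"
    by blast
  from macaulay_rep_unique[OF assms r] show "v = (\<Sum>j=J..s. (k j + 1) choose (j + 1))"
    unfolding v by (intro sum.cong) auto
qed (use assms in blast)

text \<open>Applies \<open>macaulay_op m\<close>, \<open>macaulay_op (m + 1)\<close>, \<dots>, \<open>macaulay_op (m + d - 1)\<close>
  in this order, and nothing if \<open>d = 0\<close>.\<close>

definition macaulay_iter :: "nat \<Rightarrow> nat \<Rightarrow> nat \<Rightarrow> nat" where
  "macaulay_iter m d c = fold macaulay_op [m..<m + d] c"

end

theory Submission
  imports Defs "Jordan_Normal_Form.Schur_Decomposition"
    "HOL-Computational_Algebra.Fundamental_Theorem_Algebra"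
begin

text \<open>Diagonalize the coefficient matrix, so that \<open>r = \<Sum>j. ev j * |u j|\<^sup>2\<close> with orthonormal forms
  \<open>u j\<close>. If a functional \<open>w\<close> on forms of degree \<open>m + d\<close> kills all \<open>z\<^sup>\<gamma> u j\<close> with \<open>ev j > 0\<close>, then
  pairing the squared norm \<open>r * \<parallel>z\<parallel>\<^sup>2\<^sup>d\<close> with \<open>w\<close> gives a number which is both nonnegative and a
  sum of nonpositive terms, so \<open>w\<close> also kills the \<open>z\<^sup>\<gamma> u j\<close> with \<open>ev j < 0\<close>. Hence in degree \<open>m + d\<close>
  the ideal generated by all \<open>u j\<close> with \<open>ev j \<noteq> 0\<close> has dimension at most \<open>P * D n d\<close>, while
  Macaulay's theorem bounds its codimension by the iterated operation.

  Macaulay's theorem is proved for inverse systems, i.e. spaces of functionals closed under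
  contraction by variables. Their leading monomials reduce it to sets of monomials; compressing
  in pairs of variables reduces it further to stable sets, where an induction on the number of
  variables and the degree bounds both the growth and the restriction to a hyperplane.\<close>

section \<open>Cascade representations\<close>

text \<open>Macaulay's bound cannot be isolated: splitting a stable set along its first variable
  writes its growth as a copy of the set plus the growth of the part free of that variable. That
  part must therefore be bounded, which is Green's bound, and Green's bound in degree
  \<open>s + 1\<close> rests on itself in degree \<open>s\<close> and on Macaulay's bound with one
  variable fewer. Stability makes this splitting exact, which is why compression comes first; lex
  segments never appear. Functionals replace the ideal because contraction by a variable divides the
  leading monomial of a functional whenever that variable occurs in it. So the leading monomials of
  one degree lie in the growth of those one degree lower, without Groebner bases. A functional
  \<open>w\<close> may be paired with the squared norm because an identity between Hermitian
  polynomials is an identity of coefficients, and survives replacing each monomial by an arbitrary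
  number \<open>w \<delta>\<close>. Full-length cascades are used instead of Macaulay
  representations so that two numbers can be compared term by term over the same indices.\<close>

definition cascade :: "nat \<Rightarrow> nat \<Rightarrow> (nat \<Rightarrow> nat) \<Rightarrow> bool" where
  "cascade s c k \<longleftrightarrow> strict_mono_on {..<s} k \<and> c = (\<Sum>j<s. k j choose Suc j)"

text \<open>Pascal's rule from the bottom up: by strictness the lower terms together fit under
  \<open>k s choose (s + f)\<close>, which merges with the top term into one binomial.\<close>

lemma cascade_sum_le:
  assumes "strict_mono_on {..<Suc s} k"
  shows "(\<Sum>j<Suc s. k j choose (Suc j + f)) \<le> Suc (k s) choose (Suc s + f)"
  using assms
proof (induction s)
  case (Suc s)
  have "strict_mono_on {..<Suc s} k" and lt: "k s < k (Suc s)"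
    using Suc.prems by (auto simp: strict_mono_on_def)
  then have "(\<Sum>j<Suc s. k j choose (Suc j + f)) \<le> Suc (k s) choose (Suc s + f)"
    using Suc.IH by blast
  also have "\<dots> \<le> k (Suc s) choose (Suc s + f)"
    using lt by (intro binomial_right_mono) simp
  finally show ?case by simp
qed simp

text \<open>Strictness comes from the bottom term \<open>k 0 choose 1 = k 0\<close>. With a shift
  \<open>f > 0\<close> it would fail at \<open>k 0 = 0\<close>.\<close>

lemma cascade_sum_less:
  assumes "strict_mono_on {..<Suc s} k"
  shows "(\<Sum>j<Suc s. k j choose Suc j) < Suc (k s) choose Suc s"
  using assms
proof (induction s)
  case (Suc s)
  have "strict_mono_on {..<Suc s} k" and lt: "k s < k (Suc s)"
    using Suc.prems by (auto simp: strict_mono_on_def)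
  then have "(\<Sum>j<Suc s. k j choose Suc j) < Suc (k s) choose Suc s"
    using Suc.IH by blast
  also have "\<dots> \<le> k (Suc s) choose Suc s"
    using lt by (intro binomial_right_mono) simp
  finally show ?case by simp
qed simp

text \<open>The size of a cascade is decided lexicographically from the top entry, and the shifts
  \<open>e\<close> and \<open>f\<close> respect that order weakly. The pair \<open>1, 1\<close>
  gives the Macaulay operation, the pair \<open>0, 1\<close> the sum in Green's argument.\<close>

lemma cascade_sum_mono:
  assumes "strict_mono_on {..<s} k" "strict_mono_on {..<s} k'"
    and "(\<Sum>j<s. k j choose Suc j) \<le> (\<Sum>j<s. k' j choose Suc j)"
  shows "(\<Sum>j<s. (k j + e) choose (Suc j + f)) \<le> (\<Sum>j<s. (k' j + e) choose (Suc j + f))"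
  using assms
proof (induction s)
  case (Suc s)
  have mono: "strict_mono_on {..<s} k" "strict_mono_on {..<s} k'"
    using Suc.prems by (auto simp: strict_mono_on_def)
  consider "k s < k' s" | "k s = k' s" | "k' s < k s" by linarith
  then show ?case
  proof cases
    case 1
    have "(\<Sum>j<Suc s. (k j + e) choose (Suc j + f)) \<le> Suc (k s + e) choose (Suc s + f)"
      using Suc.prems(1) by (intro cascade_sum_le) (auto simp: strict_mono_on_def)
    also have "\<dots> \<le> (k' s + e) choose (Suc s + f)"
      using 1 by (intro binomial_right_mono) simp
    finally show ?thesis by simp
  next
    case 2
    then show ?thesis using Suc.IH[OF mono] Suc.prems(3) by simp
  next
    case 3
    have "(\<Sum>j<Suc s. k' j choose Suc j) < Suc (k' s) choose Suc s"
      by (rule cascade_sum_less[OF Suc.prems(2)])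
    also have "\<dots> \<le> k s choose Suc s"
      using 3 by (intro binomial_right_mono) simp
    finally show ?thesis using Suc.prems(3) by simp
  qed
qed simp

lemma strict_mono_on_lessThan_ge:
  fixes k :: "nat \<Rightarrow> nat"
  assumes "strict_mono_on {..<s} k" "j < s"
  shows "j \<le> k j"
  using assms(2)
proof (induction j)
  case (Suc j)
  then have "k j < k (Suc j)" using assms(1) by (auto simp: strict_mono_on_def)
  with Suc show ?case by simp
qed simp

text \<open>A Macaulay representation is padded below \<open>J\<close> by vanishing binomial coefficients.\<close>

lemma macaulay_rep_cascade:
  assumes "macaulay_rep s c J k"
  defines "k' \<equiv> \<lambda>j. if Suc j < J then j else k (Suc j)"
  shows "cascade s c k'" "macaulay_op s c = (\<Sum>j<s. (k' j + 1) choose (j + 2))"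
proof -
  have J: "0 < J" "J \<le> Suc s" using assms by (auto simp: macaulay_rep_def)
  have pad: "(\<Sum>j=J..s. g j (k j)) = (\<Sum>j<s. g (Suc j) (k' j))"
    if "\<And>j. g (Suc j) j = 0" for g :: "nat \<Rightarrow> nat \<Rightarrow> nat"
  proof -
    have "(\<Sum>j<s. g (Suc j) (k' j)) = (\<Sum>j\<in>{J - 1..<s}. g (Suc j) (k' j))"
      by (rule sum.mono_neutral_right) (use that in \<open>auto simp: k'_def\<close>)
    also have "\<dots> = (\<Sum>j\<in>{J - 1..<s}. g (Suc j) (k (Suc j)))"
      by (rule sum.cong) (auto simp: k'_def)
    also have "\<dots> = (\<Sum>j=J..s. g j (k j))"
      using J sum.shift_bounds_Suc_ivl[of "\<lambda>j. g j (k j)" "J - 1" s]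
      by (simp add: atLeastLessThanSuc_atLeastAtMost[symmetric] del: sum.op_ivl_Suc)
    finally show ?thesis by simp
  qed
  have "strict_mono_on {..<s} k'"
  proof (rule strict_mono_onI)
    fix i j assume ij: "i \<in> {..<s}" "j \<in> {..<s}" "i < j"
    have sm: "strict_mono_on {J..s} k" using assms by (simp add: macaulay_rep_def)
    consider "Suc j < J" | "Suc i < J" "J \<le> Suc j" | "J \<le> Suc i" by linarith
    then show "k' i < k' j"
    proof cases
      case 2
      then have "Suc j \<le> k (Suc j)" using macaulay_rep_ge[OF assms(1), of "Suc j"] ij by auto
      then show ?thesis using 2 ij by (simp add: k'_def)
    next
      case 3
      then show ?thesis using ij strict_mono_onD[OF sm, of "Suc i" "Suc j"]
        by (auto simp: k'_def)
    qed (use ij in \<open>auto simp: k'_def\<close>)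
  qed
  moreover have "c = (\<Sum>j<s. k' j choose Suc j)"
    using pad[of "\<lambda>j x. x choose j"] assms(1) by (simp add: macaulay_rep_def)
  ultimately show "cascade s c k'" by (simp add: cascade_def)
  show "macaulay_op s c = (\<Sum>j<s. (k' j + 1) choose (j + 2))"
    using pad[of "\<lambda>j x. (x + 1) choose (j + 1)"] by (simp add: macaulay_op_eq[OF assms(1)])
qed

lemma cascade_exists:
  assumes "s \<ge> 1"
  obtains k where "cascade s c k"
  using macaulay_rep_exists[OF assms] macaulay_rep_cascade(1) by blast

text \<open>Comparing the given cascade with the padded Macaulay representation in both directions
  takes the place of a uniqueness proof for cascades.\<close>

lemma macaulay_op_cascade:
  assumes "s \<ge> 1" "cascade s c k"
  shows "macaulay_op s c = (\<Sum>j<s. (k j + 1) choose (j + 2))"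
proof -
  obtain J h where h: "macaulay_rep s c J h" using macaulay_rep_exists[OF assms(1)] by blast
  obtain k' where k': "cascade s c k'" "macaulay_op s c = (\<Sum>j<s. (k' j + 1) choose (j + 2))"
    using macaulay_rep_cascade[OF h] by blast
  have "(\<Sum>j<s. (k j + 1) choose (Suc j + 1)) \<le> (\<Sum>j<s. (k' j + 1) choose (Suc j + 1))"
    "(\<Sum>j<s. (k' j + 1) choose (Suc j + 1)) \<le> (\<Sum>j<s. (k j + 1) choose (Suc j + 1))"
    using k'(1) assms(2) by (intro cascade_sum_mono; simp add: cascade_def)+
  then show ?thesis using k'(2) by (simp del: binomial_Suc_Suc)
qed

section \<open>Monotonicity and iteration of the Macaulay operation\<close>

lemma macaulay_op_mono:
  assumes "s \<ge> 1" "c \<le> c'"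
  shows "macaulay_op s c \<le> macaulay_op s c'"
proof -
  obtain k k' where "cascade s c k" "cascade s c' k'"
    using cascade_exists[OF assms(1)] by metis
  then show ?thesis
    using cascade_sum_mono[of s k k' 1 1] assms
    by (simp add: macaulay_op_cascade[OF assms(1)])
      (simp add: cascade_def del: binomial_Suc_Suc)
qed

text \<open>The result of the operation already stands in Macaulay form one degree higher, so
  iterating only shifts indices; this yields the closed form of the iterate.\<close>

lemma macaulay_rep_shift:
  assumes "macaulay_rep s c J k"
  shows "macaulay_rep (Suc s) (macaulay_op s c) (Suc J) (\<lambda>j. k (j - 1) + 1)"
proof -
  have "macaulay_op s c = (\<Sum>j=Suc J..Suc s. (k (j - 1) + 1) choose j)"
    unfolding macaulay_op_eq[OF assms] sum.shift_bounds_cl_Suc_ivl by simp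
  moreover have "strict_mono_on {Suc J..Suc s} (\<lambda>j. k (j - 1) + 1)"
  proof (rule strict_mono_onI)
    fix i j assume "i \<in> {Suc J..Suc s}" "j \<in> {Suc J..Suc s}" "i < j"
    then have "k (i - 1) < k (j - 1)"
      using assms by (intro strict_mono_onD[of "{J..s}" k]) (auto simp: macaulay_rep_def)
    then show "k (i - 1) + 1 < k (j - 1) + 1" by simp
  qed
  ultimately show ?thesis
    using assms unfolding macaulay_rep_def by auto
qed

lemma macaulay_iter_Suc: "macaulay_iter m (Suc d) c = macaulay_op (m + d) (macaulay_iter m d c)"
  by (simp add: macaulay_iter_def)

lemma macaulay_iter_mono:
  assumes "m \<ge> 1" "c \<le> c'"
  shows "macaulay_iter m d c \<le> macaulay_iter m d c'"
  by (induction d) (use assms in \<open>auto simp: macaulay_iter_Suc macaulay_op_mono macaulay_iter_def\<close>)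

lemma macaulay_rep_iter:
  assumes "macaulay_rep m c J k"
  shows "macaulay_rep (m + d) (macaulay_iter m d c) (J + d) (\<lambda>j. k (j - d) + d)"
proof (induction d)
  case (Suc d)
  show ?case
    using macaulay_rep_shift[OF Suc] by (simp add: macaulay_iter_Suc)
qed (use assms in \<open>simp add: macaulay_iter_def\<close>)

lemma macaulay_iter_eq:
  assumes "macaulay_rep m c J k"
  shows "macaulay_iter m d c = (\<Sum>j=J..m. (k j + d) choose (j + d))"
proof -
  have "macaulay_iter m d c = (\<Sum>j=J + d..m + d. (k (j - d) + d) choose j)"
    using macaulay_rep_iter[OF assms] by (simp add: macaulay_rep_def)
  then show ?thesis by (simp add: sum.shift_bounds_cl_nat_ivl)
qed

section \<open>The arithmetic of Green's bound\<close>

text \<open>\<open>\<Sum>j<s. (k j - 1) choose Suc j\<close> is Green's bound for the number of monomials which avoid one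
  variable.\<close>

lemma macaulay_op_restricted:
  assumes "s \<ge> 1" "cascade s c k" "b \<le> (\<Sum>j<s. (k j - 1) choose Suc j)"
  shows "macaulay_op s b \<le> (\<Sum>j<s. k j choose (j + 2))"
proof -
  have sm: "strict_mono_on {..<s} k" using assms(2) by (simp add: cascade_def)
  \<comment> \<open>Truncated subtraction loses strictness when \<open>k 0 = 0\<close>. Raising the
    entry to \<open>j\<close> where \<open>k j = j\<close> restores it, and there the binomials
    compared below vanish on both sides.\<close>
  define h where "h j = max (k j - 1) j" for j
  have h: "h j = (if k j = j then j else k j - 1)" if "j < s" for j
    using strict_mono_on_lessThan_ge[OF sm that] by (auto simp: h_def)
  have h': "h j choose Suc j = (k j - 1) choose Suc j" 
    "Suc (h j) choose (j + 2) = k j choose (j + 2)" if "j < s" for j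
    using h[OF that] strict_mono_on_lessThan_ge[OF sm that]
    by (auto simp: binomial_eq_0 simp del: binomial_Suc_Suc)
  have "strict_mono_on {..<s} h"
  proof (rule strict_mono_onI)
    fix i j assume "i \<in> {..<s}" "j \<in> {..<s}" "i < j"
    then show "h i < h j" using strict_mono_onD[OF sm, of i j] by (auto simp: h_def)
  qed
  then have c: "cascade s (\<Sum>j<s. (k j - 1) choose Suc j) h"
    using h' by (simp add: cascade_def)
  have "macaulay_op s b \<le> macaulay_op s (\<Sum>j<s. (k j - 1) choose Suc j)"
    using assms by (intro macaulay_op_mono)
  also have "\<dots> = (\<Sum>j<s. k j choose (j + 2))"
    using h'(2) by (subst macaulay_op_cascade[OF assms(1) c]) (intro sum.cong, auto)
  finally show ?thesis .
qed

text \<open>Here \<open>a0\<close> counts the monomials free of the first variable and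
  \<open>a - a0\<close> the others. Were \<open>a0\<close> above Green's bound, Pascal's rule would
  leave at most \<open>b\<close> for \<open>a - a0\<close>, and the last assumption would push
  \<open>a0\<close> back under the bound.\<close>

lemma restricted_bound_step:
  assumes "cascade (Suc s) a k" "a0 \<le> a" "cascade s (a - a0) l"
    and "a0 \<le> (\<Sum>j<s. l j choose (j + 2))"
  shows "a0 \<le> (\<Sum>j<Suc s. (k j - 1) choose Suc j)"
proof (rule ccontr)
  assume "\<not> ?thesis"
  then have gt: "(\<Sum>j<Suc s. (k j - 1) choose Suc j) < a0" by simp
  have sm: "strict_mono_on {..<Suc s} k" using assms(1) by (simp add: cascade_def)
  have k1: "1 \<le> k (Suc j)" if "j < s" for j
    using strict_mono_on_lessThan_ge[OF sm, of "Suc j"] that by simp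
  define b where "b = (\<Sum>j<s. (k (Suc j) - 1) choose Suc j)"
  have pascal: "k (Suc j) choose Suc (Suc j) =
      ((k (Suc j) - 1) choose Suc (Suc j)) + ((k (Suc j) - 1) choose Suc j)" if "j < s" for j
    using k1[OF that] by (cases "k (Suc j)") auto
  have "a = k 0 + (\<Sum>j<s. k (Suc j) choose Suc (Suc j))"
    using assms(1) unfolding cascade_def sum.lessThan_Suc_shift by simp
  \<comment> \<open>The \<open>Suc\<close> pays for truncation in the bottom term,
    \<open>k 0 \<le> Suc (k 0 - 1)\<close>; the strict inequality \<open>gt\<close> absorbs
    it.\<close>
  also have "\<dots> \<le> Suc ((k 0 - 1) + (\<Sum>j<s. (k (Suc j) - 1) choose Suc (Suc j)) + b)"
    using pascal by (simp add: b_def sum.distrib)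
  also have "\<dots> = Suc ((\<Sum>j<Suc s. (k j - 1) choose Suc j) + b)"
    by (simp add: sum.lessThan_Suc_shift del: sum.lessThan_Suc)
  finally have "a - a0 \<le> b" using gt by linarith
  moreover have smb: "strict_mono_on {..<s} (\<lambda>j. k (Suc j) - 1)"
  proof (rule strict_mono_onI)
    fix i j assume "i \<in> {..<s}" "j \<in> {..<s}" "i < j"
    then show "k (Suc i) - 1 < k (Suc j) - 1"
      using strict_mono_onD[OF sm, of "Suc i" "Suc j"] k1[of i] by auto
  qed
  ultimately have "(\<Sum>j<s. l j choose (j + 2)) \<le> (\<Sum>j<s. (k (Suc j) - 1) choose (j + 2))"
    using assms(3) cascade_sum_mono[of s l "\<lambda>j. k (Suc j) - 1" 0 1]
    by (simp add: cascade_def b_def)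
  also have "\<dots> \<le> (\<Sum>j<Suc s. (k j - 1) choose Suc j)"
    by (simp add: sum.lessThan_Suc_shift del: sum.lessThan_Suc)
  finally show False using gt assms(4) by simp
qed


section \<open>Macaulay's theorem for stable sets of monomials\<close>

abbreviation mons :: "nat \<Rightarrow> nat \<Rightarrow> nat list set" where
  "mons n k \<equiv> {\<alpha>. length \<alpha> = n \<and> sum_list \<alpha> = k}"

text \<open>If \<open>A\<close> consists of the monomials of degree \<open>k - 1\<close> outside a
  monomial ideal generated in that degree, this is the set of monomials of degree \<open>k\<close>
  outside it.\<close>

definition growth :: "nat \<Rightarrow> nat \<Rightarrow> nat list set \<Rightarrow> nat list set" where
  "growth n k A = {\<alpha> \<in> mons n k. \<forall>i<n. 0 < \<alpha> ! i \<longrightarrow> \<alpha>[i := \<alpha> ! i - 1] \<in> A}"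

text \<open>Strong stability in the sense of Borel-fixed ideals, but imposed on the monomials
  outside the ideal, so that these favour the first variables.\<close>

definition stable :: "nat \<Rightarrow> nat list set \<Rightarrow> bool" where
  "stable n A \<longleftrightarrow> (\<forall>\<alpha>\<in>A. \<forall>i j. i < j \<longrightarrow> j < n \<longrightarrow> 0 < \<alpha> ! j \<longrightarrow>
     \<alpha>[j := \<alpha> ! j - 1, i := Suc (\<alpha> ! i)] \<in> A)"

definition restrict0 :: "nat list set \<Rightarrow> nat list set" where
  "restrict0 A = {\<beta>. 0 # \<beta> \<in> A}"

definition colon0 :: "nat list set \<Rightarrow> nat list set" where
  "colon0 A = {a # \<beta> | a \<beta>. Suc a # \<beta> \<in> A}"

lemma finite_mons [simp]: "finite (mons n k)"
  using finite_set[of "multi_indices n k"] by (simp add: set_multi_indices)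

lemma card_mons: "n \<ge> 1 \<Longrightarrow> card (mons n k) = D n k"
  using distinct_card[OF distinct_multi_indices[of n k]]
  by (simp add: set_multi_indices length_multi_indices)

lemma sum_list_inc: "i < length \<alpha> \<Longrightarrow> sum_list (\<alpha>[i := Suc (\<alpha> ! i)]) = Suc (sum_list \<alpha>)"
  for \<alpha> :: "nat list"
  using elem_le_sum_list[of i \<alpha>] by (simp add: sum_list_update)

lemma sum_list_dec:
  "i < length \<alpha> \<Longrightarrow> 0 < \<alpha> ! i \<Longrightarrow> Suc (sum_list (\<alpha>[i := \<alpha> ! i - 1])) = sum_list \<alpha>"
  for \<alpha> :: "nat list"
  using elem_le_sum_list[of i \<alpha>] by (simp add: sum_list_update)

lemma finite_subset_mons: "A \<subseteq> mons n k \<Longrightarrow> finite A"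
  by (rule finite_subset[OF _ finite_mons])

lemma growth_subset: "growth n k A \<subseteq> mons n k"
  by (auto simp: growth_def)

lemma restrict0_subset: "A \<subseteq> mons (Suc n) k \<Longrightarrow> restrict0 A \<subseteq> mons n k"
  by (auto simp: restrict0_def)

lemma colon0_subset: "A \<subseteq> mons (Suc n) (Suc k) \<Longrightarrow> colon0 A \<subseteq> mons (Suc n) k"
  by (auto simp: colon0_def)

lemma card_restrict0_colon0:
  assumes "A \<subseteq> mons (Suc n) k"
  shows "card A = card (restrict0 A) + card (colon0 A)"
proof -
  have fin: "finite A" using assms by (rule finite_subset_mons)
  have inj: "inj_on (\<lambda>\<alpha>. Suc (hd \<alpha>) # tl \<alpha>) (colon0 A)"
    by (auto simp: inj_on_def colon0_def)
  have A: "A = (#) 0 ` restrict0 A \<union> (\<lambda>\<alpha>. Suc (hd \<alpha>) # tl \<alpha>) ` colon0 A"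
  proof (intro equalityI subsetI)
    fix \<alpha> assume \<alpha>: "\<alpha> \<in> A"
    then obtain a \<beta> where [simp]: "\<alpha> = a # \<beta>" using assms by (cases \<alpha>) auto
    show "\<alpha> \<in> (#) 0 ` restrict0 A \<union> (\<lambda>\<alpha>. Suc (hd \<alpha>) # tl \<alpha>) ` colon0 A"
      using \<alpha> by (cases a) (force simp: restrict0_def colon0_def image_iff)+
  qed (auto simp: restrict0_def colon0_def)
  have "finite (restrict0 A)" "finite (colon0 A)"
    using fin A inj finite_imageD[of "(#) 0" "restrict0 A"] finite_imageD[OF _ inj]
    by (metis finite_Un inj_on_Cons1)+
  then have "card ((#) 0 ` restrict0 A \<union> (\<lambda>\<alpha>. Suc (hd \<alpha>) # tl \<alpha>) ` colon0 A)
      = card (restrict0 A) + card (colon0 A)"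
    using inj by (subst card_Un_disjoint) (auto simp: card_image)
  then show ?thesis using A by simp
qed

lemma stable_restrict0:
  assumes "stable (Suc n) A"
  shows "stable n (restrict0 A)"
  unfolding stable_def restrict0_def
proof (clarify)
  fix \<beta> i j assume "0 # \<beta> \<in> A" "i < j" "j < n" "0 < \<beta> ! j"
  then show "0 # \<beta>[j := \<beta> ! j - 1, i := Suc (\<beta> ! i)] \<in> A"
    using assms[unfolded stable_def, rule_format, of "0 # \<beta>" "Suc i" "Suc j"] by simp
qed

lemma stable_to_head:
  assumes "stable (Suc n) A" "a # \<beta> \<in> A" "j < n" "0 < \<beta> ! j"
  shows "Suc a # \<beta>[j := \<beta> ! j - 1] \<in> A"
  using assms(1)[unfolded stable_def, rule_format, of "a # \<beta>" 0 "Suc j"] assms(2-) by simp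

lemma stable_colon0:
  assumes "stable (Suc n) A"
  shows "stable (Suc n) (colon0 A)"
  unfolding stable_def
proof (clarify)
  fix \<alpha> i j assume "\<alpha> \<in> colon0 A" and ij: "i < j" "j < Suc n" "0 < \<alpha> ! j"
  then obtain a \<beta> where \<alpha>: "\<alpha> = a # \<beta>" "Suc a # \<beta> \<in> A" by (auto simp: colon0_def)
  have "(Suc a # \<beta>)[j := (Suc a # \<beta>) ! j - 1, i := Suc ((Suc a # \<beta>) ! i)] \<in> A"
    using assms[unfolded stable_def, rule_format, OF \<alpha>(2) ij(1,2)] ij \<alpha> by (cases j) auto
  then show "\<alpha>[j := \<alpha> ! j - 1, i := Suc (\<alpha> ! i)] \<in> colon0 A"
    using ij by (cases j; cases i) (auto simp: \<alpha> colon0_def)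
qed

lemma restrict0_growth: "restrict0 (growth (Suc n) k A) = growth n k (restrict0 A)"
  by (auto simp: growth_def restrict0_def All_less_Suc2)

text \<open>Dividing the product of the first variable and \<open>\<alpha>\<close> by another
  variable amounts to moving one unit of \<open>\<alpha>\<close> to the head, which stability
  allows. So growth contains a full copy of \<open>A\<close>.\<close>

lemma colon0_growth:
  assumes "A \<subseteq> mons (Suc n) k" "stable (Suc n) A"
  shows "colon0 (growth (Suc n) (Suc k) A) = A"
proof (intro equalityI subsetI)
  fix \<alpha> assume \<alpha>: "\<alpha> \<in> A"
  then obtain a \<beta> where [simp]: "\<alpha> = a # \<beta>" using assms by (cases \<alpha>) auto
  have "Suc a # \<beta> \<in> growth (Suc n) (Suc k) A"
    using \<alpha> assms stable_to_head[OF assms(2), of a \<beta>] by (auto simp: growth_def All_less_Suc2)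
  then show "\<alpha> \<in> colon0 (growth (Suc n) (Suc k) A)" by (auto simp: colon0_def)
qed (auto simp: colon0_def growth_def All_less_Suc2)

text \<open>Removing a unit from a monomial free of the first variable and giving it to the head
  stays in \<open>A\<close>. This lets a growth bound in \<open>n\<close> variables and one degree
  lower control the restriction.\<close>

lemma restrict0_subset_growth:
  assumes "A \<subseteq> mons (Suc n) k" "stable (Suc n) A"
  shows "restrict0 A \<subseteq> growth n k (restrict0 (colon0 A))"
  using assms stable_to_head[OF assms(2)] by (auto simp: growth_def restrict0_def colon0_def)

text \<open>Green's bound for stable sets. Assuming Macaulay's bound in \<open>n\<close> variables,
  the degree is lowered by passing to \<open>colon0 A\<close>.\<close>

lemma card_restrict0_le:
  assumes step: "\<And>k A. k \<ge> 1 \<Longrightarrow> A \<subseteq> mons n k \<Longrightarrow> stable n A \<Longrightarrow>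
      card (growth n (Suc k) A) \<le> macaulay_op k (card A)"
    and "A \<subseteq> mons (Suc n) (Suc s)" "stable (Suc n) A" "cascade (Suc s) (card A) k"
  shows "card (restrict0 A) \<le> (\<Sum>j<Suc s. (k j - 1) choose Suc j)"
  using assms(2-)
proof (induction s arbitrary: A k)
  case 0
  have card: "card A = card (restrict0 A) + card (colon0 A)"
    by (rule card_restrict0_colon0[OF 0(1)])
  have "finite (colon0 A)" by (rule finite_subset_mons[OF colon0_subset[OF 0(1)]])
  \<comment> \<open>In degree one the bound is \<open>card A - 1\<close>: any other variable in
    \<open>A\<close> forces the first one into \<open>A\<close>.\<close>
  moreover have "colon0 A \<noteq> {}" if \<beta>: "\<beta> \<in> restrict0 A" for \<beta>
  proof -
    have \<beta>': "0 # \<beta> \<in> A" "length \<beta> = n" "sum_list \<beta> = 1" using \<beta> 0(1) by (auto simp: restrict0_def)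
    then obtain j where "j < n" "0 < \<beta> ! j"
      by (metis gr0I in_set_conv_nth sum_list_eq_0_iff zero_neq_one)
    then show ?thesis
      using stable_to_head[OF 0(2) \<beta>'(1)] unfolding colon0_def by blast
  qed
  ultimately have "card (restrict0 A) = 0 \<or> 0 < card (colon0 A)"
    by (metis card.empty card_gt_0_iff ex_in_conv)
  then show ?case using card 0(3) by (auto simp: cascade_def)
next
  case (Suc s)
  note sub = colon0_subset[OF Suc.prems(1)] and st = stable_colon0[OF Suc.prems(2)]
  have card: "card A = card (restrict0 A) + card (colon0 A)"
    by (rule card_restrict0_colon0[OF Suc.prems(1)])
  obtain l where l: "cascade (Suc s) (card (colon0 A)) l" using cascade_exists[of "Suc s"] by auto
  have "card (restrict0 A) \<le> card (growth n (Suc (Suc s)) (restrict0 (colon0 A)))"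
    using restrict0_subset_growth[OF Suc.prems(1,2)] finite_subset_mons[OF growth_subset]
    by (rule card_mono[rotated])
  also have "\<dots> \<le> macaulay_op (Suc s) (card (restrict0 (colon0 A)))"
    using step restrict0_subset[OF sub] stable_restrict0[OF st] by simp
  also have "\<dots> \<le> (\<Sum>j<Suc s. l j choose (j + 2))"
    using Suc.IH[OF sub st l] l by (intro macaulay_op_restricted) simp_all
  finally show ?case
    using l card by (intro restricted_bound_step[OF Suc.prems(3)]) simp_all
qed

text \<open>Growth splits into \<open>A\<close> and the growth of its restriction. With Green's
  bound for the latter the two cascades add up by Pascal's rule to exactly the Macaulay
  operation.\<close>

lemma card_growth_stable:
  assumes "k \<ge> 1" "A \<subseteq> mons n k" "stable n A"
  shows "card (growth n (Suc k) A) \<le> macaulay_op k (card A)"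
  using assms
proof (induction n arbitrary: k A)
  case 0
  then have "growth 0 (Suc k) A = {}" by (auto simp: growth_def)
  then show ?case by simp
next
  case (Suc n)
  obtain s where s: "k = Suc s" using Suc.prems(1) by (cases k) auto
  obtain h where h: "cascade k (card A) h" using cascade_exists[OF Suc.prems(1)] by blast
  have "card (restrict0 A) \<le> (\<Sum>j<k. (h j - 1) choose Suc j)"
    using card_restrict0_le[of n A s h] Suc h by (simp add: s)
  then have op: "macaulay_op k (card (restrict0 A)) \<le> (\<Sum>j<k. h j choose (j + 2))"
    using macaulay_op_restricted[OF Suc.prems(1) h] by simp
  have "card (growth (Suc n) (Suc k) A)
      = card (restrict0 (growth (Suc n) (Suc k) A)) + card (colon0 (growth (Suc n) (Suc k) A))"
    by (rule card_restrict0_colon0[OF growth_subset])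
  also have "\<dots> = card (growth n (Suc k) (restrict0 A)) + card A"
    using Suc.prems by (simp add: restrict0_growth colon0_growth)
  also have "\<dots> \<le> (\<Sum>j<k. h j choose (j + 2)) + card A"
    using Suc.IH[OF Suc.prems(1) restrict0_subset[OF Suc.prems(2)] stable_restrict0[OF Suc.prems(3)]]
      op by simp
  also have "\<dots> = macaulay_op k (card A)"
    unfolding macaulay_op_cascade[OF Suc.prems(1) h]
    using h by (simp add: cascade_def sum.distrib)
  finally show ?case .
qed


section \<open>Compression\<close>

text \<open>The multi-indices of a given degree which agree outside the positions \<open>i\<close> and \<open>j\<close> form a
  fibre; it is indexed by its member \<open>\<kappa>\<close> with \<open>\<kappa> ! i = 0\<close>, and its members are determined by
  their entry \<open>b\<close> at \<open>j\<close>.\<close>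

definition fibre_key :: "nat \<Rightarrow> nat \<Rightarrow> nat list \<Rightarrow> nat list" where
  "fibre_key i j \<alpha> = \<alpha>[i := 0, j := \<alpha> ! i + \<alpha> ! j]"

definition fibre_elem :: "nat \<Rightarrow> nat \<Rightarrow> nat list \<Rightarrow> nat \<Rightarrow> nat list" where
  "fibre_elem i j \<kappa> b = \<kappa>[i := \<kappa> ! j - b, j := b]"

definition fibre :: "nat \<Rightarrow> nat \<Rightarrow> nat list set \<Rightarrow> nat list \<Rightarrow> nat set" where
  "fibre i j A \<kappa> = {b. b \<le> \<kappa> ! j \<and> fibre_elem i j \<kappa> b \<in> A}"

text \<open>Each fibre is replaced by equally many of its members, those with the smallest exponents
  at \<open>j\<close>.\<close>

definition compress :: "nat \<Rightarrow> nat \<Rightarrow> nat \<Rightarrow> nat \<Rightarrow> nat list set \<Rightarrow> nat list set" where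
  "compress n k i j A = {\<alpha> \<in> mons n k. \<alpha> ! j < card (fibre i j A (fibre_key i j \<alpha>))}"

text \<open>A potential: shifting exponents towards earlier positions lowers it, so a set of least
  cost is fixed by all compressions.\<close>

definition cost :: "nat list \<Rightarrow> nat" where
  "cost \<alpha> = (\<Sum>l<length \<alpha>. l * \<alpha> ! l)"

lemma cost_update:
  assumes "i < length \<alpha>"
  shows "cost (\<alpha>[i := x]) + i * \<alpha> ! i = cost \<alpha> + i * x"
proof -
  have "cost (\<alpha>[i := x]) = i * x + (\<Sum>l\<in>{..<length \<alpha>} - {i}. l * \<alpha> ! l)"
    using assms by (simp add: cost_def sum.remove[of _ i])
  moreover have "cost \<alpha> = i * \<alpha> ! i + (\<Sum>l\<in>{..<length \<alpha>} - {i}. l * \<alpha> ! l)"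
    using assms by (simp add: cost_def sum.remove[of _ i])
  ultimately show ?thesis by simp
qed

text \<open>The initial segment and \<open>X\<close> differ by equally many elements, those of the
  segment being below \<open>card X\<close> and those of \<open>X\<close> at least
  \<open>card X\<close>.\<close>

lemma sum_lessThan_card_less:
  assumes "finite X" "X \<noteq> {..<card X}"
  shows "\<Sum>{..<card X} < \<Sum>(X :: nat set)"
proof -
  let ?c = "card X"
  let ?I = "{..<?c}"
  have eq: "card (X - ?I) = card (?I - X)"
    using card_Diff_subset_Int[of X ?I] card_Diff_subset_Int[of ?I X] assms(1)
    by (simp add: Int_commute)
  have "?I - X \<noteq> {}"
    using assms card_subset_eq[of X ?I] by auto
  then have pos: "0 < card (?I - X)" by (simp add: card_gt_0_iff)
  have "\<Sum>(?I - X) < card (?I - X) * ?c"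
    using pos sum_bounded_above_strict[of "?I - X" "\<lambda>x. x" ?c] by auto
  also have "\<dots> \<le> \<Sum>(X - ?I)"
    using sum_bounded_below[of "X - ?I" ?c "\<lambda>x. x"] eq by auto
  finally show ?thesis
    using sum.Int_Diff[OF assms(1), of "\<lambda>x. x" ?I] sum.Int_Diff[of ?I "\<lambda>x. x" X]
    by (simp add: Int_commute)
qed

context
  fixes n i j :: nat
  assumes ij: "i < j" "j < n"
begin

lemma fibre_elem_mons:
  assumes "\<kappa> \<in> mons n k" "\<kappa> ! i = 0" "b \<le> \<kappa> ! j"
  shows "fibre_elem i j \<kappa> b \<in> mons n k"
  using assms ij elem_le_sum_list[of j \<kappa>]
  by (simp add: fibre_elem_def sum_list_update)

lemma fibre_key_elem:
  assumes "\<kappa> \<in> mons n k" "\<kappa> ! i = 0" "b \<le> \<kappa> ! j"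
  shows "fibre_key i j (fibre_elem i j \<kappa> b) = \<kappa>"
  using assms ij by (intro nth_equalityI) (auto simp: fibre_key_def fibre_elem_def nth_list_update)

lemma fibre_key_mons:
  assumes "\<alpha> \<in> mons n k"
  shows "fibre_key i j \<alpha> \<in> mons n k" "fibre_key i j \<alpha> ! i = 0" "\<alpha> ! j \<le> fibre_key i j \<alpha> ! j"
    "fibre_elem i j (fibre_key i j \<alpha>) (\<alpha> ! j) = \<alpha>"
proof -
  show "fibre_elem i j (fibre_key i j \<alpha>) (\<alpha> ! j) = \<alpha>"
    using assms ij by (intro nth_equalityI) (auto simp: fibre_key_def fibre_elem_def nth_list_update)
  show "fibre_key i j \<alpha> \<in> mons n k"
    using assms ij elem_le_sum_list[of i \<alpha>] by (simp add: fibre_key_def sum_list_update)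
qed (use assms ij in \<open>auto simp: fibre_key_def\<close>)

text \<open>Reduces counting (\<open>g = 1\<close>) and cost comparisons (\<open>g = cost\<close>)
  to a single fibre.\<close>

lemma sum_fibres:
  assumes "X \<subseteq> mons n k"
  shows "(\<Sum>\<alpha>\<in>X. g \<alpha>) =
    (\<Sum>\<kappa>\<in>{\<kappa> \<in> mons n k. \<kappa> ! i = 0}. \<Sum>b\<in>fibre i j X \<kappa>. g (fibre_elem i j \<kappa> b))"
proof -
  let ?K = "{\<kappa> \<in> mons n k. \<kappa> ! i = 0}"
  have "(\<Sum>\<alpha>\<in>X. g \<alpha>) = (\<Sum>(\<kappa>, b)\<in>Sigma ?K (fibre i j X). g (fibre_elem i j \<kappa> b))"
  proof (rule sum.reindex_bij_witness[where i = "\<lambda>(\<kappa>, b). fibre_elem i j \<kappa> b"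
        and j = "\<lambda>\<alpha>. (fibre_key i j \<alpha>, \<alpha> ! j)"])
    fix \<alpha> assume \<alpha>: "\<alpha> \<in> X"
    then have k: "\<alpha> \<in> mons n k" using assms by blast
    note key = fibre_key_mons[OF k]
    show "(case (fibre_key i j \<alpha>, \<alpha> ! j) of (\<kappa>, b) \<Rightarrow> fibre_elem i j \<kappa> b) = \<alpha>"
      using key(4) by simp
    show "(fibre_key i j \<alpha>, \<alpha> ! j) \<in> Sigma ?K (fibre i j X)"
      unfolding fibre_def using key \<alpha> by simp
    show "(case (fibre_key i j \<alpha>, \<alpha> ! j) of (\<kappa>, b) \<Rightarrow> g (fibre_elem i j \<kappa> b)) = g \<alpha>"
      using key(4) by simp
  next
    fix p assume "p \<in> Sigma ?K (fibre i j X)"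
    then obtain \<kappa> b where p: "p = (\<kappa>, b)" "\<kappa> \<in> mons n k" "\<kappa> ! i = 0" "b \<in> fibre i j X \<kappa>" by blast
    then have b: "b \<le> \<kappa> ! j" "fibre_elem i j \<kappa> b \<in> X" by (simp_all add: fibre_def)
    have "fibre_elem i j \<kappa> b ! j = b" using ij p(2) by (simp add: fibre_elem_def)
    then show "(fibre_key i j (case p of (\<kappa>, b) \<Rightarrow> fibre_elem i j \<kappa> b),
        (case p of (\<kappa>, b) \<Rightarrow> fibre_elem i j \<kappa> b) ! j) = p"
      using fibre_key_elem[OF p(2,3) b(1)] p(1) by simp
    show "(case p of (\<kappa>, b) \<Rightarrow> fibre_elem i j \<kappa> b) \<in> X" using b p(1) by simp
  qed
  also have "\<dots> = (\<Sum>\<kappa>\<in>?K. \<Sum>b\<in>fibre i j X \<kappa>. g (fibre_elem i j \<kappa> b))"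
  proof (rule sum.Sigma[symmetric])
    show "finite ?K" by (rule finite_subset[OF _ finite_mons[of n k]]) auto
    show "\<forall>\<kappa>\<in>?K. finite (fibre i j X \<kappa>)" by (simp add: fibre_def)
  qed
  finally show ?thesis .
qed

lemma card_fibre_le: "card (fibre i j X \<kappa>) \<le> Suc (\<kappa> ! j)"
  using card_mono[of "{..\<kappa> ! j}" "fibre i j X \<kappa>"] by (auto simp: fibre_def)

lemma fibre_compress:
  assumes "\<kappa> \<in> mons n k" "\<kappa> ! i = 0"
  shows "fibre i j (compress n k i j A) \<kappa> = {..<card (fibre i j A \<kappa>)}"
proof -
  have "fibre_elem i j \<kappa> b \<in> compress n k i j A \<longleftrightarrow> b < card (fibre i j A \<kappa>)" if "b \<le> \<kappa> ! j" for b
  proof -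
    have "fibre_elem i j \<kappa> b ! j = b" using assms ij by (simp add: fibre_elem_def)
    then show ?thesis
      using fibre_elem_mons[OF assms that]
      unfolding compress_def mem_Collect_eq fibre_key_elem[OF assms that] by simp
  qed
  then show ?thesis using card_fibre_le[of A \<kappa>] by (auto simp: fibre_def[of i j "compress n k i j A"])
qed

lemma compress_subset: "compress n k i j A \<subseteq> mons n k"
  by (auto simp: compress_def)

lemma card_compress:
  assumes "A \<subseteq> mons n k"
  shows "card (compress n k i j A) = card A"
proof -
  have "(\<Sum>\<alpha>\<in>compress n k i j A. 1) = (\<Sum>\<alpha>\<in>A. 1 :: nat)"
    unfolding sum_fibres[OF compress_subset] sum_fibres[OF assms]
    by (rule sum.cong) (auto simp: fibre_compress)
  then show ?thesis by simp
qed

lemma cost_fibre_elem: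
  assumes "\<kappa> \<in> mons n k" "\<kappa> ! i = 0" "b \<le> \<kappa> ! j"
  shows "int (cost (fibre_elem i j \<kappa> b)) =
    (int (cost \<kappa>) - (int j - int i) * int (\<kappa> ! j)) + (int j - int i) * int b"
proof -
  have "cost (fibre_elem i j \<kappa> b) + j * \<kappa> ! j = cost (\<kappa>[i := \<kappa> ! j - b]) + j * b"
    using cost_update[of j "\<kappa>[i := \<kappa> ! j - b]" b] assms ij by (simp add: fibre_elem_def)
  moreover have "cost (\<kappa>[i := \<kappa> ! j - b]) = cost \<kappa> + i * (\<kappa> ! j - b)"
    using cost_update[of i \<kappa> "\<kappa> ! j - b"] assms ij by simp
  ultimately have "int (cost (fibre_elem i j \<kappa> b)) + int j * int (\<kappa> ! j)
      = int (cost \<kappa>) + int i * int (\<kappa> ! j - b) + int j * int b"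
    by (simp only: of_nat_add[symmetric] of_nat_mult[symmetric])
  then show ?thesis using assms(3) by (simp add: of_nat_diff algebra_simps)
qed

lemma cost_compress_fibre:
  assumes \<kappa>: "\<kappa> \<in> mons n k" "\<kappa> ! i = 0" and ne: "fibre i j A \<kappa> \<noteq> {..<card (fibre i j A \<kappa>)}"
  shows "(\<Sum>b<card (fibre i j A \<kappa>). cost (fibre_elem i j \<kappa> b))
    < (\<Sum>b\<in>fibre i j A \<kappa>. cost (fibre_elem i j \<kappa> b))"
proof -
  let ?X = "fibre i j A \<kappa>"
  let ?c = "int (cost \<kappa>) - (int j - int i) * int (\<kappa> ! j)"
  have fin: "finite ?X" by (rule finite_subset[of _ "{..\<kappa> ! j}"]) (auto simp: fibre_def)
  have eq: "int (\<Sum>b\<in>Y. cost (fibre_elem i j \<kappa> b)) = int (card Y) * ?c + (int j - int i) * int (\<Sum>Y)"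
    if "Y \<subseteq> {..\<kappa> ! j}" for Y
    using that cost_fibre_elem[OF \<kappa>] by (simp add: sum.distrib sum_distrib_left subset_eq)
  have "int (\<Sum>b<card ?X. cost (fibre_elem i j \<kappa> b)) =
      int (card ?X) * ?c + (int j - int i) * int (\<Sum>{..<card ?X})"
    using card_fibre_le[of A \<kappa>] by (subst eq) auto
  also have "\<dots> < int (card ?X) * ?c + (int j - int i) * int (\<Sum>?X)"
    using sum_lessThan_card_less[OF fin ne] ij by (simp del: of_nat_sum)
  also have "\<dots> = int (\<Sum>b\<in>?X. cost (fibre_elem i j \<kappa> b))"
    by (rule eq[symmetric]) (auto simp: fibre_def)
  finally show ?thesis by (simp only: of_nat_less_iff)
qed

lemma cost_compress:
  assumes A: "A \<subseteq> mons n k" and ne: "compress n k i j A \<noteq> A"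
  shows "sum cost (compress n k i j A) < sum cost A"
proof -
  have ex: "\<exists>\<kappa>\<in>{\<kappa> \<in> mons n k. \<kappa> ! i = 0}. fibre i j A \<kappa> \<noteq> {..<card (fibre i j A \<kappa>)}"
  proof (rule ccontr)
    assume "\<not> ?thesis"
    then have eq: "fibre i j A (fibre_key i j \<alpha>) = {..<card (fibre i j A (fibre_key i j \<alpha>))}"
      if "\<alpha> \<in> mons n k" for \<alpha>
      using fibre_key_mons[OF that] by blast
    have "\<alpha> \<in> A \<longleftrightarrow> \<alpha> ! j \<in> fibre i j A (fibre_key i j \<alpha>)" if "\<alpha> \<in> mons n k" for \<alpha>
      using fibre_key_mons[OF that] by (simp add: fibre_def)
    then have "compress n k i j A = A" using eq A by (auto simp: compress_def)
    then show False using ne by simp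
  qed
  show ?thesis
    unfolding sum_fibres[OF compress_subset] sum_fibres[OF A]
  proof (rule sum_strict_mono_ex1)
    show "finite {\<kappa> \<in> mons n k. \<kappa> ! i = 0}" by (rule finite_subset[OF _ finite_mons[of n k]]) auto
    show "\<forall>\<kappa>\<in>{\<kappa> \<in> mons n k. \<kappa> ! i = 0}.
        (\<Sum>b\<in>fibre i j (compress n k i j A) \<kappa>. cost (fibre_elem i j \<kappa> b))
        \<le> (\<Sum>b\<in>fibre i j A \<kappa>. cost (fibre_elem i j \<kappa> b))"
    proof
      fix \<kappa> assume \<kappa>: "\<kappa> \<in> {\<kappa> \<in> mons n k. \<kappa> ! i = 0}"
      then show "(\<Sum>b\<in>fibre i j (compress n k i j A) \<kappa>. cost (fibre_elem i j \<kappa> b))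
          \<le> (\<Sum>b\<in>fibre i j A \<kappa>. cost (fibre_elem i j \<kappa> b))"
        using cost_compress_fibre[of \<kappa> k A]
        by (cases "fibre i j A \<kappa> = {..<card (fibre i j A \<kappa>)}") (simp_all add: fibre_compress)
    qed
    show "\<exists>\<kappa>\<in>{\<kappa> \<in> mons n k. \<kappa> ! i = 0}.
        (\<Sum>b\<in>fibre i j (compress n k i j A) \<kappa>. cost (fibre_elem i j \<kappa> b))
        < (\<Sum>b\<in>fibre i j A \<kappa>. cost (fibre_elem i j \<kappa> b))"
      using ex cost_compress_fibre[of _ k A] by (auto simp: fibre_compress)
  qed
qed

text \<open>In two variables a set of \<open>c \<le> t\<close> monomials of degree \<open>t - 1\<close> grows to at most \<open>c\<close> monomials
  of degree \<open>t\<close>, and only the set of all monomials grows to \<open>c + 1\<close>.\<close>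

lemma card_interval_growth:
  fixes t :: nat
  assumes U: "U \<subseteq> {..t}" and X: "X \<subseteq> {..<t}"
    and "\<And>b. b \<in> U \<Longrightarrow> b < t \<Longrightarrow> b \<in> X" "\<And>b. b \<in> U \<Longrightarrow> 0 < b \<Longrightarrow> b - 1 \<in> X"
  shows "card U \<le> card X \<or> X = {..<t}"
proof (cases "X = {..<t}")
  case False
  then obtain y where y: "y < t" "y \<notin> X" using X by blast
  then have "y \<notin> U" "Suc y \<notin> U" using assms(3)[of y] assms(4)[of "Suc y"] by auto
  then have b: "b < y \<or> Suc y < b" if "b \<in> U" for b
    using that by (metis not_less_less_Suc_eq linorder_neqE_nat)
  \<comment> \<open>\<open>U\<close> misses both \<open>y\<close> and \<open>Suc y\<close>, so
    closing up the gap by lowering everything above it keeps images distinct and away from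
    \<open>y\<close>.\<close>
  define f where "f b = (if b < y then b else b - 1)" for b
  have "inj_on f U"
    using b by (fastforce simp: inj_on_def f_def split: if_splits)
  moreover have "f ` U \<subseteq> X"
    using b assms(3,4) y by (fastforce simp: f_def)
  moreover have "finite X" using X finite_subset by blast
  ultimately show ?thesis using card_inj_on_le by blast
qed simp

text \<open>Fibre by fibre: if a fibre of the growth of \<open>A\<close> has \<open>c\<close>
  elements, the first \<open>c\<close> positions of that fibre all lie in the growth of the
  compressed set. Each divisor of such a monomial has to be checked.\<close>

lemma card_growth_compress:
  assumes A: "A \<subseteq> mons n k"
  shows "card (growth n (Suc k) A) \<le> card (growth n (Suc k) (compress n k i j A))"
proof -
  let ?C = "compress n k i j A"
  have sub: "{..<card (fibre i j (growth n (Suc k) A) \<kappa>)} \<subseteq> fibre i j (growth n (Suc k) ?C) \<kappa>"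
    if \<kappa>: "\<kappa> \<in> mons n (Suc k)" "\<kappa> ! i = 0" for \<kappa>
  proof
    let ?U = "fibre i j (growth n (Suc k) A) \<kappa>"
    fix b assume "b \<in> {..<card ?U}"
    then have b: "b < card ?U" "b \<le> \<kappa> ! j" using card_fibre_le[of "growth n (Suc k) A" \<kappa>] by auto
    have len: "length \<kappa> = n" using \<kappa> by simp
    let ?\<alpha> = "fibre_elem i j \<kappa> b"
    have "?\<alpha>[l := ?\<alpha> ! l - 1] \<in> ?C" if l: "l < n" "0 < ?\<alpha> ! l" for l
    proof -
      have \<alpha>k: "?\<alpha>[l := ?\<alpha> ! l - 1] \<in> mons n k"
        using fibre_elem_mons[OF \<kappa> b(2)] l sum_list_dec[of l ?\<alpha>] by auto
      show ?thesis
      proof (cases "l = i \<or> l = j")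
        case False
        \<comment> \<open>Dividing by a third variable maps the fibre over \<open>\<kappa>\<close>
          into the one over this key and leaves the exponent at \<open>j\<close> alone, so the
          target has at least as many elements of \<open>A\<close>.\<close>
        let ?\<kappa> = "\<kappa>[l := \<kappa> ! l - 1]"
        have key: "fibre_key i j (?\<alpha>[l := ?\<alpha> ! l - 1]) = ?\<kappa>"
          using False ij l len \<kappa>(2) b(2)
          by (intro nth_equalityI) (auto simp: fibre_key_def fibre_elem_def nth_list_update)
        have el: "fibre_elem i j ?\<kappa> x = (fibre_elem i j \<kappa> x)[l := (fibre_elem i j \<kappa> x) ! l - 1]"
          "0 < (fibre_elem i j \<kappa> x) ! l" for x
          using False ij l len
          by (auto intro!: nth_equalityI simp: fibre_elem_def nth_list_update)
        have "?U \<subseteq> fibre i j A ?\<kappa>"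
          using False l el len by (auto simp: fibre_def growth_def)
        moreover have "finite (fibre i j A ?\<kappa>)"
          by (rule finite_subset[of _ "{..?\<kappa> ! j}"]) (auto simp: fibre_def)
        ultimately have "card ?U \<le> card (fibre i j A ?\<kappa>)" by (rule card_mono[rotated])
        moreover have "?\<alpha>[l := ?\<alpha> ! l - 1] ! j = b"
          using False ij len by (simp add: fibre_elem_def)
        ultimately show ?thesis using b \<alpha>k unfolding compress_def mem_Collect_eq key by simp
      next
        case True
        \<comment> \<open>Divisions by variable \<open>i\<close> and by variable \<open>j\<close>
          land in the same fibre of degree one less, where the two-variable count applies.\<close>
        let ?\<kappa> = "\<kappa>[j := \<kappa> ! j - 1]"
        let ?X = "fibre i j A ?\<kappa>"
        have bi: "b < \<kappa> ! j" if "l = i" using that l ij len by (simp add: fibre_elem_def)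
        have bj: "0 < b" if "l = j" using that l ij len by (simp add: fibre_elem_def)
        have t: "0 < \<kappa> ! j" using True bi bj b by auto
        have key: "fibre_key i j (?\<alpha>[l := ?\<alpha> ! l - 1]) = ?\<kappa>"
        proof (rule nth_equalityI)
          fix x assume "x < length (fibre_key i j (?\<alpha>[l := ?\<alpha> ! l - 1]))"
          then have x: "x < n" using len by (simp add: fibre_key_def fibre_elem_def)
          consider "x = i" | "x = j" | "x \<noteq> i" "x \<noteq> j" by blast
          then show "fibre_key i j (?\<alpha>[l := ?\<alpha> ! l - 1]) ! x = ?\<kappa> ! x"
          proof cases
            case 2
            then show ?thesis
              using True ij len bi bj b(2) by (auto simp: fibre_key_def fibre_elem_def)
          qed (use True ij len \<kappa>(2) x in \<open>auto simp: fibre_key_def fibre_elem_def\<close>)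
        qed (use len in \<open>simp add: fibre_key_def fibre_elem_def\<close>)
        have eli: "fibre_elem i j ?\<kappa> x = (fibre_elem i j \<kappa> x)[i := (fibre_elem i j \<kappa> x) ! i - 1]" for x
        proof -
          have "fibre_elem i j \<kappa> x ! i = \<kappa> ! j - x" using ij len by (simp add: fibre_elem_def)
          then show ?thesis
            using ij len by (simp add: fibre_elem_def list_update_swap[of i j])
        qed
        have elj: "fibre_elem i j ?\<kappa> (x - 1) = (fibre_elem i j \<kappa> x)[j := (fibre_elem i j \<kappa> x) ! j - 1]"
          if "0 < x" for x
          using that ij len by (simp add: fibre_elem_def list_update_swap[of i j])
        have gr: "(fibre_elem i j \<kappa> x)[l := (fibre_elem i j \<kappa> x) ! l - 1] \<in> A"
          if "x \<in> ?U" "l < n" "0 < fibre_elem i j \<kappa> x ! l" for x l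
          using that by (simp add: fibre_def growth_def)
        have "card ?U \<le> card ?X \<or> ?X = {..<\<kappa> ! j}"
        proof (rule card_interval_growth)
          fix x assume x: "x \<in> ?U"
          show "x \<in> ?X" if "x < \<kappa> ! j"
          proof -
            have "0 < fibre_elem i j \<kappa> x ! i" using that ij len by (simp add: fibre_elem_def)
            then show ?thesis using gr[OF x, of i] that eli ij len by (simp add: fibre_def)
          qed
          show "x - 1 \<in> ?X" if "0 < x"
          proof -
            have "0 < fibre_elem i j \<kappa> x ! j" using that ij len by (simp add: fibre_elem_def)
            then show ?thesis using gr[OF x, of j] elj[OF that] ij len x by (simp add: fibre_def diff_le_mono)
          qed
        qed (use t ij len in \<open>auto simp: fibre_def\<close>)
        then have disj: "b < card ?X \<or> card ?X = \<kappa> ! j"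
          using b(1) by (elim disjE) (linarith, metis card_lessThan)
        \<comment> \<open>In the exceptional case of a full fibre of size
          \<open>\<kappa> ! j\<close> there is still room: division by \<open>j\<close> lowers
          \<open>b\<close>, and division by \<open>i\<close> presupposes
          \<open>b < \<kappa> ! j\<close>.\<close>
        have "?\<alpha>[l := ?\<alpha> ! l - 1] ! j < card ?X"
        proof (cases "l = j")
          case True
          then have "?\<alpha>[l := ?\<alpha> ! l - 1] ! j = b - 1" using ij len by (simp add: fibre_elem_def)
          then show ?thesis using disj bj[OF True] b(2) by linarith
        next
          case False
          then have "?\<alpha>[l := ?\<alpha> ! l - 1] ! j = b" using ij len by (simp add: fibre_elem_def)
          then show ?thesis using disj bi False True b(2) by linarith
        qed
        then show ?thesis using \<alpha>k unfolding compress_def mem_Collect_eq key by blast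
      qed
    qed
    then have "?\<alpha> \<in> growth n (Suc k) ?C"
      using fibre_elem_mons[OF \<kappa> b(2)] by (simp add: growth_def)
    then show "b \<in> fibre i j (growth n (Suc k) ?C) \<kappa>" using b by (simp add: fibre_def)
  qed
  have le: "card (fibre i j (growth n (Suc k) A) \<kappa>) \<le> card (fibre i j (growth n (Suc k) ?C) \<kappa>)"
    if "\<kappa> \<in> mons n (Suc k)" "\<kappa> ! i = 0" for \<kappa>
  proof -
    have "finite (fibre i j (growth n (Suc k) ?C) \<kappa>)"
      by (rule finite_subset[of _ "{..\<kappa> ! j}"]) (auto simp: fibre_def)
    from card_mono[OF this sub[OF that]] show ?thesis by simp
  qed
  have "(\<Sum>\<alpha>\<in>growth n (Suc k) A. 1) \<le> (\<Sum>\<alpha>\<in>growth n (Suc k) ?C. 1 :: nat)"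
    unfolding sum_fibres[OF growth_subset] by (rule sum_mono) (use le in auto)
  then show ?thesis by simp
qed

end

text \<open>In a compressed set membership within a fibre means an exponent at \<open>j\<close>
  below a threshold; the move stays in the fibre and lowers that exponent.\<close>

lemma stable_if_compressed:
  assumes A: "A \<subseteq> mons n k"
    and comp: "\<And>i j. i < j \<Longrightarrow> j < n \<Longrightarrow> compress n k i j A = A"
  shows "stable n A"
  unfolding stable_def
proof (clarify)
  fix \<alpha> i j assume \<alpha>: "\<alpha> \<in> A" and ij: "i < j" "j < n" and pos: "0 < \<alpha> ! j"
  let ?\<beta> = "\<alpha>[j := \<alpha> ! j - 1, i := Suc (\<alpha> ! i)]"
  have len: "length \<alpha> = n" "sum_list \<alpha> = k" using \<alpha> A by auto
  have "sum_list ?\<beta> = k"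
    using len ij pos sum_list_inc[of i "\<alpha>[j := \<alpha> ! j - 1]"] sum_list_dec[of j \<alpha>] by simp
  moreover have "fibre_key i j ?\<beta> = fibre_key i j \<alpha>"
    using len ij pos by (intro nth_equalityI) (auto simp: fibre_key_def nth_list_update)
  moreover have "\<alpha> ! j < card (fibre i j A (fibre_key i j \<alpha>))"
    using comp[OF ij] \<alpha> by (auto simp: compress_def)
  ultimately have "?\<beta> \<in> compress n k i j A"
    using len ij by (simp add: compress_def)
  then show "?\<beta> \<in> A" using comp[OF ij] by simp
qed

text \<open>Among the sets of the same size whose growth is at least as large, one of least cost is
  compressed for every pair of variables, hence stable.\<close>

theorem card_growth_le:
  assumes "k \<ge> 1" "A \<subseteq> mons n k"
  shows "card (growth n (Suc k) A) \<le> macaulay_op k (card A)"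
proof -
  define P where "P A' \<longleftrightarrow> A' \<subseteq> mons n k \<and> card A' = card A \<and>
    card (growth n (Suc k) A) \<le> card (growth n (Suc k) A')" for A'
  have "P A" using assms by (simp add: P_def)
  from exists_least_iff[of "\<lambda>x. \<exists>A'. P A' \<and> sum cost A' = x"] this
  obtain A' where A': "P A'" and min: "\<And>A''. P A'' \<Longrightarrow> \<not> sum cost A'' < sum cost A'"
    by metis
  have "compress n k i j A' = A'" if ij: "i < j" "j < n" for i j
  proof (rule ccontr)
    assume ne: "compress n k i j A' \<noteq> A'"
    have "P (compress n k i j A')"
      using A' card_compress[OF ij, of A' k] card_growth_compress[OF ij, of A' k]
        compress_subset[OF ij, of k A']
      unfolding P_def by linarith
    then show False using min cost_compress[OF ij _ ne] A' by (auto simp: P_def)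
  qed
  then have "stable n A'" using A' by (intro stable_if_compressed[of A' n k]) (auto simp: P_def)
  then show ?thesis
    using card_growth_stable[OF assms(1), of A' n] A' by (auto simp: P_def)
qed


section \<open>Leading monomials of inverse systems\<close>

lemma homogeneous_system_nontrivial:
  fixes M :: "'e \<Rightarrow> 's \<Rightarrow> 'a :: field"
  assumes "finite E" "finite S" "card E < card S"
  shows "\<exists>x. (\<exists>s\<in>S. x s \<noteq> 0) \<and> (\<forall>e\<in>E. (\<Sum>s\<in>S. M e s * x s) = 0)"
  using assms
proof (induction E arbitrary: M S rule: finite_induct)
  case empty
  then have "S \<noteq> {}" by auto
  then show ?case by (intro exI[of _ "\<lambda>_. 1"]) auto
next
  case (insert e E)
  show ?case
  proof (cases "\<forall>s\<in>S. M e s = 0")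
    case True
    obtain x where "\<exists>s\<in>S. x s \<noteq> 0" "\<forall>e\<in>E. (\<Sum>s\<in>S. M e s * x s) = 0"
      using insert.IH[OF insert.prems(1), of M] insert.prems(2) insert.hyps by auto
    then show ?thesis using True by auto
  next
    case False
    then obtain p where p: "p \<in> S" "M e p \<noteq> 0" by blast
    have "finite (S - {p})" and "card E < card (S - {p})" using insert p by auto
    \<comment> \<open>Gaussian elimination: equation \<open>e\<close> removes the unknown
      \<open>p\<close> from the others, and \<open>z\<close> below is the value it then forces on
      \<open>p\<close>.\<close>
    from insert.IH[OF this, of "\<lambda>e' s. M e' s - M e' p * M e s / M e p"]
    obtain y where y: "\<exists>s\<in>S - {p}. y s \<noteq> 0"
      "\<forall>e'\<in>E. (\<Sum>s\<in>S - {p}. (M e' s - M e' p * M e s / M e p) * y s) = 0"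
      by blast
    define z where "z = - (\<Sum>s\<in>S - {p}. M e s * y s) / M e p"
    have split: "(\<Sum>s\<in>S. M e' s * (y(p := z)) s) = M e' p * z + (\<Sum>s\<in>S - {p}. M e' s * y s)" for e'
      using p insert.prems by (simp add: sum.remove)
    have "(\<Sum>s\<in>S. M e' s * (y(p := z)) s) = 0" if "e' \<in> insert e E" for e'
    proof (cases "e' = e")
      case True
      then show ?thesis unfolding split using p by (simp add: z_def)
    next
      case False
      then have "0 = (\<Sum>s\<in>S - {p}. (M e' s - M e' p * M e s / M e p) * y s)" using y that by auto
      also have "\<dots> = (\<Sum>s\<in>S - {p}. M e' s * y s) - (\<Sum>s\<in>S - {p}. M e' p / M e p * (M e s * y s))"
        by (simp add: sum_subtractf[symmetric] left_diff_distrib mult.assoc)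
      also have "\<dots> = M e' p * z + (\<Sum>s\<in>S - {p}. M e' s * y s)"
        unfolding sum_distrib_left[symmetric] z_def by simp
      finally show ?thesis unfolding split by simp
    qed
    moreover have "\<exists>s\<in>S. (y(p := z)) s \<noteq> 0" using y(1) by auto
    ultimately show ?thesis by blast
  qed
qed

definition leading :: "('a \<Rightarrow> nat) \<Rightarrow> 'a set \<Rightarrow> ('a \<Rightarrow> complex) set \<Rightarrow> 'a set" where
  "leading \<omega> S K = {\<alpha> \<in> S. \<exists>w\<in>K. w \<alpha> \<noteq> 0 \<and> (\<forall>\<beta>\<in>S. w \<beta> \<noteq> 0 \<longrightarrow> \<omega> \<beta> \<le> \<omega> \<alpha>)}"

text \<open>Otherwise the equations in \<open>E\<close>, together with vanishing at every leading
  position, have a nonzero solution. It lies in \<open>K\<close>, so its own leading position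
  contradicts the vanishing.\<close>

lemma card_leading_ge:
  assumes S: "finite S" and E: "finite E"
    and K: "\<And>w. (\<forall>e\<in>E. (\<Sum>\<alpha>\<in>S. M e \<alpha> * w \<alpha>) = 0) \<Longrightarrow> w \<in> K"
  shows "card S \<le> card (leading \<omega> S K) + card E"
proof (rule ccontr)
  assume "\<not> ?thesis"
  then have less: "card (Inl ` leading \<omega> S K \<union> Inr ` E :: ('a + 'b) set) < card S"
    using card_Un_le[of "Inl ` leading \<omega> S K" "Inr ` E :: ('a + 'b) set"]
      card_image_le[OF E, of Inr]
    by (simp add: card_image)
  have fin: "finite (leading \<omega> S K)" using S by (simp add: leading_def)
  \<comment> \<open>An equation tagged \<open>Inl \<beta>\<close> says \<open>w \<beta> = 0\<close>;
    those tagged \<open>Inr\<close> are the given ones.\<close>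
  define M' where "M' = (\<lambda>e \<alpha>. case e of Inl \<beta> \<Rightarrow> of_bool (\<alpha> = \<beta>) | Inr e \<Rightarrow> M e \<alpha>)"
  obtain w where w: "\<exists>\<alpha>\<in>S. w \<alpha> \<noteq> 0"
    "\<forall>e\<in>Inl ` leading \<omega> S K \<union> Inr ` E. (\<Sum>\<alpha>\<in>S. M' e \<alpha> * w \<alpha>) = 0"
    using homogeneous_system_nontrivial[OF _ S less, of M'] fin E by auto
  have "(\<Sum>\<alpha>\<in>S. M e \<alpha> * w \<alpha>) = 0" if "e \<in> E" for e
    using w(2)[rule_format, of "Inr e"] that by (simp add: M'_def)
  then have "w \<in> K" using K by blast
  define T where "T = {\<alpha> \<in> S. w \<alpha> \<noteq> 0}"
  have T: "finite T" "T \<noteq> {}" using S w by (auto simp: T_def)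
  then have "Max (\<omega> ` T) \<in> \<omega> ` T" by simp
  then obtain \<alpha> where \<alpha>: "\<alpha> \<in> T" "\<omega> \<alpha> = Max (\<omega> ` T)" by auto
  then have "\<omega> \<beta> \<le> \<omega> \<alpha>" if "\<beta> \<in> S" "w \<beta> \<noteq> 0" for \<beta>
    using T that by (auto simp: T_def)
  then have lead: "\<alpha> \<in> leading \<omega> S K"
    using \<alpha> \<open>w \<in> K\<close> by (auto simp: leading_def T_def)
  have "w \<alpha> = (\<Sum>\<beta>\<in>S. M' (Inl \<alpha>) \<beta> * w \<beta>)"
    using \<alpha> S by (simp add: M'_def T_def of_bool_def if_distrib[of "\<lambda>x. x * _"] cong: if_cong)
  also have "\<dots> = 0" using w(2) lead by blast
  finally show False using \<alpha> by (simp add: T_def)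
qed

text \<open>With more leading positions than elements of \<open>Z\<close>, some nontrivial
  combination of the chosen functionals is also killed by \<open>Z\<close>, hence zero on
  \<open>S\<close>. But at the largest position with nonzero coefficient only one term survives, by
  injectivity of \<open>\<omega>\<close>.\<close>

lemma card_leading_le:
  assumes S: "finite S" "inj_on \<omega> S" and Z: "finite Z"
    and K: "\<And>w e. w \<in> K \<Longrightarrow> e \<in> E \<Longrightarrow> (\<Sum>\<alpha>\<in>S. M e \<alpha> * w \<alpha>) = 0"
    and sep: "\<And>w \<alpha>. (\<forall>e\<in>E \<union> Z. (\<Sum>\<alpha>\<in>S. M e \<alpha> * w \<alpha>) = 0) \<Longrightarrow> \<alpha> \<in> S \<Longrightarrow> w \<alpha> = 0"
  shows "card (leading \<omega> S K) \<le> card Z"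
proof (rule ccontr)
  let ?L = "leading \<omega> S K"
  assume "\<not> ?thesis"
  then have less: "card Z < card ?L" by simp
  have fin: "finite ?L" using S by (simp add: leading_def)
  have "\<exists>w. \<forall>\<alpha>\<in>?L. w \<alpha> \<in> K \<and> w \<alpha> \<alpha> \<noteq> 0 \<and> (\<forall>\<beta>\<in>S. w \<alpha> \<beta> \<noteq> 0 \<longrightarrow> \<omega> \<beta> \<le> \<omega> \<alpha>)"
    by (intro bchoice) (auto simp: leading_def)
  then obtain w where w: "\<And>\<alpha>. \<alpha> \<in> ?L \<Longrightarrow> w \<alpha> \<in> K" "\<And>\<alpha>. \<alpha> \<in> ?L \<Longrightarrow> w \<alpha> \<alpha> \<noteq> 0"
    "\<And>\<alpha> \<beta>. \<alpha> \<in> ?L \<Longrightarrow> \<beta> \<in> S \<Longrightarrow> w \<alpha> \<beta> \<noteq> 0 \<Longrightarrow> \<omega> \<beta> \<le> \<omega> \<alpha>"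
    by blast
  obtain x where x: "\<exists>\<alpha>\<in>?L. x \<alpha> \<noteq> 0"
    "\<forall>e\<in>Z. (\<Sum>\<alpha>\<in>?L. (\<Sum>\<beta>\<in>S. M e \<beta> * w \<alpha> \<beta>) * x \<alpha>) = 0"
    using homogeneous_system_nontrivial[OF Z fin less, of "\<lambda>e \<alpha>. \<Sum>\<beta>\<in>S. M e \<beta> * w \<alpha> \<beta>"] by blast
  define v where "v \<beta> = (\<Sum>\<alpha>\<in>?L. w \<alpha> \<beta> * x \<alpha>)" for \<beta>
  have "(\<Sum>\<beta>\<in>S. M e \<beta> * v \<beta>) = (\<Sum>\<alpha>\<in>?L. (\<Sum>\<beta>\<in>S. M e \<beta> * w \<alpha> \<beta>) * x \<alpha>)" for e
    unfolding v_def sum_distrib_left sum_distrib_right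
    by (subst sum.swap) (simp add: mult.assoc)
  then have "(\<Sum>\<beta>\<in>S. M e \<beta> * v \<beta>) = 0" if "e \<in> E \<union> Z" for e
    using that x(2) K[OF w(1)] by auto
  then have v0: "v \<beta> = 0" if "\<beta> \<in> S" for \<beta>
    using sep that by blast
  define T where "T = {\<alpha> \<in> ?L. x \<alpha> \<noteq> 0}"
  have T: "finite T" "T \<noteq> {}" using fin x by (auto simp: T_def)
  then have "Max (\<omega> ` T) \<in> \<omega> ` T" by simp
  then obtain \<alpha> where \<alpha>: "\<alpha> \<in> T" "\<omega> \<alpha> = Max (\<omega> ` T)" by auto
  have \<alpha>L: "\<alpha> \<in> ?L" "x \<alpha> \<noteq> 0" "\<alpha> \<in> S" using \<alpha> by (auto simp: T_def leading_def)
  have "w \<beta> \<alpha> * x \<beta> = 0" if \<beta>: "\<beta> \<in> ?L - {\<alpha>}" for \<beta>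
  proof (rule ccontr)
    assume ne: "w \<beta> \<alpha> * x \<beta> \<noteq> 0"
    then have "\<omega> \<alpha> \<le> \<omega> \<beta>" using w(3)[of \<beta> \<alpha>] \<beta> \<alpha>L by auto
    moreover have "\<omega> \<beta> \<le> \<omega> \<alpha>" using \<alpha> T \<beta> ne by (auto simp: T_def)
    ultimately have "\<beta> = \<alpha>"
      using inj_onD[OF S(2), of \<beta> \<alpha>] \<alpha>L \<beta> by (auto simp: leading_def)
    then show False using \<beta> by simp
  qed
  then have "(\<Sum>\<beta>\<in>?L - {\<alpha>}. w \<beta> \<alpha> * x \<beta>) = 0" by (rule sum.neutral[OF ballI])
  then have "v \<alpha> = w \<alpha> \<alpha> * x \<alpha>"
    unfolding v_def sum.remove[OF fin \<alpha>L(1)] by simp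
  then show False using v0 \<alpha>L w(2) by simp
qed

text \<open>Exponent vectors are encoded in base \<open>b\<close>; the code orders them like a monomial order and
  also serves for Kronecker substitution.\<close>

abbreviation code :: "nat \<Rightarrow> nat list \<Rightarrow> nat" where
  "code b \<equiv> horner_sum (\<lambda>x. x) b"

lemma code_inject:
  assumes "length \<alpha> = length \<beta>" "\<forall>x\<in>set \<alpha>. x < b" "\<forall>x\<in>set \<beta>. x < b" "code b \<alpha> = code b \<beta>"
  shows "\<alpha> = \<beta>"
  using assms
proof (induction \<alpha> \<beta> rule: list_induct2)
  case (Cons x xs y ys)
  then have "(x + b * code b xs) mod b = (y + b * code b ys) mod b"
    "(x + b * code b xs) div b = (y + b * code b ys) div b"
    by simp_all
  then show ?case using Cons by simp
qed simp

lemma code_inc: "i < length \<alpha> \<Longrightarrow> code b (\<alpha>[i := Suc (\<alpha> ! i)]) = code b \<alpha> + b ^ i"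
proof (induction \<alpha> arbitrary: i)
  case (Cons a \<alpha>)
  then show ?case by (cases i) (simp_all add: algebra_simps)
qed simp

lemma inj_on_code_mons: "inj_on (code (Suc k)) (mons n k)"
proof (rule inj_onI)
  fix \<alpha> \<beta> assume "\<alpha> \<in> mons n k" "\<beta> \<in> mons n k" "code (Suc k) \<alpha> = code (Suc k) \<beta>"
  then show "\<alpha> = \<beta>"
    using member_le_sum_list[of _ \<alpha>] member_le_sum_list[of _ \<beta>]
    by (intro code_inject[of \<alpha> \<beta> "Suc k"]) (auto simp: less_Suc_eq_le)
qed

text \<open>Contraction by variable \<open>i\<close> lowers all codes in the support by the same
  \<open>b ^ i\<close>, so it preserves which monomial is largest. Additivity of the code suffices
  here.\<close>

lemma leading_subset_growth:
  assumes "\<And>w i. w \<in> K' \<Longrightarrow> i < n \<Longrightarrow> (\<lambda>\<beta>. w (\<beta>[i := Suc (\<beta> ! i)])) \<in> K"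
  shows "leading (code b) (mons n (Suc k)) K' \<subseteq> growth n (Suc k) (leading (code b) (mons n k) K)"
proof
  fix \<alpha> assume "\<alpha> \<in> leading (code b) (mons n (Suc k)) K'"
  then obtain w where \<alpha>: "length \<alpha> = n" "sum_list \<alpha> = Suc k" "w \<alpha> \<noteq> 0" and w: "w \<in> K'"
    and max: "\<And>\<beta>. length \<beta> = n \<Longrightarrow> sum_list \<beta> = Suc k \<Longrightarrow> w \<beta> \<noteq> 0 \<Longrightarrow> code b \<beta> \<le> code b \<alpha>"
    by (auto simp: leading_def)
  have "\<alpha>[i := \<alpha> ! i - 1] \<in> leading (code b) (mons n k) K" if i: "i < n" "0 < \<alpha> ! i" for i
  proof -
    let ?\<alpha> = "\<alpha>[i := \<alpha> ! i - 1]"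
    have inc: "?\<alpha>[i := Suc (?\<alpha> ! i)] = \<alpha>" using i \<alpha> by simp
    have "code b \<beta> \<le> code b ?\<alpha>"
      if "length \<beta> = n" "sum_list \<beta> = k" "w (\<beta>[i := Suc (\<beta> ! i)]) \<noteq> 0" for \<beta>
      using max[of "\<beta>[i := Suc (\<beta> ! i)]"] that i \<alpha>(1) sum_list_inc[of i \<beta>] code_inc[of i \<beta> b]
        code_inc[of i ?\<alpha> b] inc by simp
    then show ?thesis
      using \<alpha> i assms[OF w i(1)] inc sum_list_dec[of i \<alpha>]
      unfolding leading_def by (auto intro!: bexI[of _ "\<lambda>\<beta>. w (\<beta>[i := Suc (\<beta> ! i)])"])
  qed
  then show "\<alpha> \<in> growth n (Suc k) (leading (code b) (mons n k) K)"
    using \<alpha> by (simp add: growth_def)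
qed

lemma card_leading_iter:
  assumes "m \<ge> 1"
    and K: "\<And>d w i. w \<in> K (Suc d) \<Longrightarrow> i < n \<Longrightarrow> (\<lambda>\<beta>. w (\<beta>[i := Suc (\<beta> ! i)])) \<in> K d"
  shows "card (leading (code b) (mons n (m + d)) (K d))
    \<le> macaulay_iter m d (card (leading (code b) (mons n m) (K 0)))"
proof (induction d)
  case (Suc d)
  let ?L = "\<lambda>d. leading (code b) (mons n (m + d)) (K d)"
  have sub: "?L d \<subseteq> mons n (m + d)" by (auto simp: leading_def)
  have "?L (Suc d) \<subseteq> growth n (Suc (m + d)) (?L d)"
    using leading_subset_growth[of "K (Suc d)" n "K d" b "m + d"] K by simp
  then have "card (?L (Suc d)) \<le> card (growth n (Suc (m + d)) (?L d))"
    by (rule card_mono[OF finite_subset_mons[OF growth_subset]])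
  also have "\<dots> \<le> macaulay_op (m + d) (card (?L d))"
    using assms(1) by (intro card_growth_le[OF _ sub]) simp
  also have "\<dots> \<le> macaulay_iter m (Suc d) (card (leading (code b) (mons n m) (K 0)))"
    using assms(1) Suc by (simp add: macaulay_iter_Suc macaulay_op_mono)
  finally show ?case .
qed (simp add: macaulay_iter_def)

section \<open>Ideals generated by forms, and their codimension\<close>

text \<open>The coefficients of \<open>z\<^sup>\<gamma> u(z)\<close> for a form \<open>u\<close> of degree \<open>m\<close>.\<close>

definition shifted :: "nat \<Rightarrow> nat \<Rightarrow> (nat list \<Rightarrow> complex) \<Rightarrow> nat list \<Rightarrow> nat list \<Rightarrow> complex" where
  "shifted n m u \<gamma> \<delta> = (\<Sum>\<alpha>\<in>mons n m. if map2 (+) \<alpha> \<gamma> = \<delta> then u \<alpha> else 0)"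

lemma map2_add_mons:
  assumes "\<alpha> \<in> mons n k" "\<gamma> \<in> mons n l"
  shows "map2 (+) \<alpha> \<gamma> \<in> mons n (k + l)"
proof -
  have "sum_list (map2 (+) \<alpha> \<gamma>) = sum_list \<alpha> + sum_list \<gamma>" if "length \<alpha> = length \<gamma>"
    for \<alpha> \<gamma> :: "nat list" using that by (induction \<alpha> \<gamma> rule: list_induct2) auto
  then show ?thesis using assms by simp
qed

text \<open>Contraction of functionals is dual to multiplication by a monomial.\<close>

lemma sum_shifted:
  assumes "\<gamma> \<in> mons n d"
  shows "(\<Sum>\<delta>\<in>mons n (m + d). shifted n m u \<gamma> \<delta> * w \<delta>)
    = (\<Sum>\<alpha>\<in>mons n m. u \<alpha> * w (map2 (+) \<alpha> \<gamma>))"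
proof -
  have "(\<Sum>\<delta>\<in>mons n (m + d). shifted n m u \<gamma> \<delta> * w \<delta>)
      = (\<Sum>\<alpha>\<in>mons n m. \<Sum>\<delta>\<in>mons n (m + d). (if map2 (+) \<alpha> \<gamma> = \<delta> then u \<alpha> * w \<delta> else 0))"
    unfolding shifted_def sum_distrib_right
    by (subst sum.swap) (simp add: if_distrib[of "\<lambda>x. x * _"] cong: if_cong)
  also have "\<dots> = (\<Sum>\<alpha>\<in>mons n m. u \<alpha> * w (map2 (+) \<alpha> \<gamma>))"
  proof (rule sum.cong)
    fix \<alpha> assume "\<alpha> \<in> mons n m"
    then have "map2 (+) \<alpha> \<gamma> \<in> mons n (m + d)" using assms by (rule map2_add_mons)
    then show "(\<Sum>\<delta>\<in>mons n (m + d). (if map2 (+) \<alpha> \<gamma> = \<delta> then u \<alpha> * w \<delta> else 0))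
        = u \<alpha> * w (map2 (+) \<alpha> \<gamma>)"
      by (subst sum.delta'[OF finite_mons]) (simp only: if_True)
  qed simp
  finally show ?thesis .
qed

text \<open>If the forms \<open>u j\<close> with \<open>j\<close> in \<open>E'\<close> generate the same space in degree \<open>m + d\<close> as those with
  \<open>j\<close> in \<open>E\<close>, then that space has dimension at most \<open>card E' * card (mons n d)\<close>, while Macaulay's
  theorem bounds its codimension.\<close>

lemma generators_bound:
  fixes u :: "'j \<Rightarrow> nat list \<Rightarrow> complex"
  assumes m: "m \<ge> 1" and Z: "finite Z" and E': "finite E'"
    and sep: "\<And>w \<alpha>. (\<forall>j\<in>E \<union> Z. (\<Sum>\<alpha>\<in>mons n m. u j \<alpha> * w \<alpha>) = 0) \<Longrightarrow> \<alpha> \<in> mons n m \<Longrightarrow> w \<alpha> = 0"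
    and gen: "\<And>w j \<gamma>. (\<forall>j\<in>E'. \<forall>\<gamma>\<in>mons n d. (\<Sum>\<delta>\<in>mons n (m + d). shifted n m (u j) \<gamma> \<delta> * w \<delta>) = 0)
      \<Longrightarrow> j \<in> E \<Longrightarrow> \<gamma> \<in> mons n d
      \<Longrightarrow> (\<Sum>\<delta>\<in>mons n (m + d). shifted n m (u j) \<gamma> \<delta> * w \<delta>) = 0"
  shows "card (mons n (m + d)) \<le> macaulay_iter m d (card Z) + card E' * card (mons n d)"
proof -
  \<comment> \<open>The inverse system in degree \<open>m + e\<close>: the functionals vanishing on
    the degree \<open>m + e\<close> part of the ideal generated by the forms of
    \<open>E\<close>.\<close>
  define K where "K e = {w. \<forall>j\<in>E. \<forall>\<gamma>\<in>mons n e. (\<Sum>\<alpha>\<in>mons n m. u j \<alpha> * w (map2 (+) \<alpha> \<gamma>)) = 0}"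
    for e
  \<comment> \<open>Base \<open>m + 1\<close> makes codes distinct in degree \<open>m\<close>, where
    \<open>card_leading_le\<close> is applied.\<close>
  define b where "b = Suc m"
  have step: "(\<lambda>\<beta>. w (\<beta>[i := Suc (\<beta> ! i)])) \<in> K e" if w: "w \<in> K (Suc e)" and i: "i < n" for e w i
  proof -
    have "(\<Sum>\<alpha>\<in>mons n m. u j \<alpha> * w ((map2 (+) \<alpha> \<gamma>)[i := Suc (map2 (+) \<alpha> \<gamma> ! i)])) = 0"
      if "j \<in> E" and \<gamma>: "\<gamma> \<in> mons n e" for j \<gamma>
    proof -
      have "(map2 (+) \<alpha> \<gamma>)[i := Suc (map2 (+) \<alpha> \<gamma> ! i)] = map2 (+) \<alpha> (\<gamma>[i := Suc (\<gamma> ! i)])"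
        if "\<alpha> \<in> mons n m" for \<alpha>
        using that \<gamma> i by (intro nth_equalityI) (auto simp: nth_list_update)
      moreover have "\<gamma>[i := Suc (\<gamma> ! i)] \<in> mons n (Suc e)"
        using \<gamma> i by (auto simp: sum_list_inc)
      ultimately show ?thesis using w \<open>j \<in> E\<close> by (simp add: K_def)
    qed
    then show ?thesis by (simp add: K_def)
  qed
  have "card (leading (code b) (mons n (m + d)) (K d))
      \<le> macaulay_iter m d (card (leading (code b) (mons n m) (K 0)))"
    by (rule card_leading_iter[OF m step])
  also have "\<dots> \<le> macaulay_iter m d (card Z)"
  proof (rule macaulay_iter_mono[OF m])
    have rep: "replicate n 0 \<in> mons n 0" by (simp add: sum_list_replicate)
    have add0: "map2 (+) \<alpha> (replicate n 0) = \<alpha>" if "\<alpha> \<in> mons n m" for \<alpha>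
      using that by (intro nth_equalityI) auto
    have K0: "(\<Sum>\<alpha>\<in>mons n m. u j \<alpha> * w \<alpha>) = 0" if w: "w \<in> K 0" and j: "j \<in> E" for w j
    proof -
      have "(\<Sum>\<alpha>\<in>mons n m. u j \<alpha> * w (map2 (+) \<alpha> (replicate n 0))) = 0"
        using w j rep unfolding K_def by blast
      moreover have "(\<Sum>\<alpha>\<in>mons n m. u j \<alpha> * w (map2 (+) \<alpha> (replicate n 0)))
          = (\<Sum>\<alpha>\<in>mons n m. u j \<alpha> * w \<alpha>)"
        by (rule sum.cong) (simp_all only: add0)
      ultimately show ?thesis by simp
    qed
    show "card (leading (code b) (mons n m) (K 0)) \<le> card Z"
      unfolding b_def
    proof (rule card_leading_le[where M = u and E = E, OF finite_mons[of n m] inj_on_code_mons Z])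
      show "w \<alpha> = 0" if "\<forall>j\<in>E \<union> Z. (\<Sum>\<alpha>\<in>mons n m. u j \<alpha> * w \<alpha>) = 0" "\<alpha> \<in> mons n m" for w \<alpha>
        by (rule sep[OF that])
    qed (rule K0)
  qed
  finally have le: "card (leading (code b) (mons n (m + d)) (K d)) \<le> macaulay_iter m d (card Z)" .
  have "card (mons n (m + d))
      \<le> card (leading (code b) (mons n (m + d)) (K d)) + card (E' \<times> mons n d)"
  proof (rule card_leading_ge[OF finite_mons])
    show "finite (E' \<times> mons n d)" using E' by simp
    fix w assume w: "\<forall>p\<in>E' \<times> mons n d.
      (\<Sum>\<delta>\<in>mons n (m + d). (case p of (j, \<gamma>) \<Rightarrow> shifted n m (u j) \<gamma>) \<delta> * w \<delta>) = 0"
    \<comment> \<open>By \<open>gen\<close> the equations coming from \<open>E'\<close> already cut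
      out \<open>K d\<close>, which is why only \<open>E'\<close> enters the count.\<close>
    then have "(\<Sum>\<delta>\<in>mons n (m + d). shifted n m (u j) \<gamma> \<delta> * w \<delta>) = 0"
      if "j \<in> E" "\<gamma> \<in> mons n d" for j \<gamma>
      using gen[OF _ that, of w] by fastforce
    then show "w \<in> K d" unfolding K_def using sum_shifted[of _ n d m] by auto
  qed
  then show ?thesis using le by (simp add: card_cartesian_product)
qed


section \<open>Hermitian forms and squared norms\<close>

lemma polynomial_zero_if_infinite_roots:
  fixes c :: "nat \<Rightarrow> complex"
  assumes "infinite X" "\<And>x. x \<in> X \<Longrightarrow> (\<Sum>i\<le>n. c i * x ^ i) = 0" "i \<le> n"
  shows "c i = 0"
proof (rule ccontr)
  assume "c i \<noteq> 0"
  then have "finite {z. (\<Sum>i\<le>n. c i * z ^ i) = 0}" using polyfun_rootbound assms(3) by blast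
  moreover have "X \<subseteq> {z. (\<Sum>i\<le>n. c i * z ^ i) = 0}" using assms(2) by blast
  ultimately show False using assms(1) finite_subset by blast
qed

lemma infinite_unit_circle: "infinite {u :: complex. cmod u = 1}"
proof
  assume "finite {u :: complex. cmod u = 1}"
  then have "finite (Re ` {u. cmod u = 1})" by simp
  moreover have "{0..1} \<subseteq> Re ` {u. cmod u = 1}"
  proof
    fix x :: real assume "x \<in> {0..1}"
    then have "x\<^sup>2 \<le> 1" by (simp add: power_le_one)
    then have "cmod (Complex x (sqrt (1 - x\<^sup>2))) = 1" by (simp add: cmod_def)
    then show "x \<in> Re ` {u. cmod u = 1}" by (force simp: image_iff)
  qed
  ultimately have "finite {0..1 :: real}" by (rule finite_subset[rotated])
  then show False using infinite_Icc[of "0 :: real" 1] by simp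
qed

text \<open>Put \<open>t = s * u\<close> with \<open>s\<close> real and \<open>u\<close> on the unit
  circle. Powers of \<open>s\<close> separate the total degree \<open>c = a + b\<close>; within one
  degree, multiplying by \<open>u ^ c\<close> turns each term into a power of
  \<open>u\<^sup>2\<close>, and these separate \<open>a\<close>.\<close>

lemma coeffs_zero_single:
  fixes e :: "nat \<Rightarrow> nat \<Rightarrow> complex"
  assumes zero: "\<And>t. (\<Sum>a\<le>N. \<Sum>b\<le>N. e a b * t ^ a * cnj t ^ b) = 0"
    and ab: "a \<le> N" "b \<le> N"
  shows "e a b = 0"
proof -
  define g where "g c x = (\<Sum>a\<le>N. \<Sum>b\<le>N. if a + b = c then e a b * x a b else 0)"
    for c and x :: "nat \<Rightarrow> nat \<Rightarrow> complex"
  have g: "(\<Sum>c\<le>2 * N. g c x * s ^ c) = (\<Sum>a\<le>N. \<Sum>b\<le>N. e a b * x a b * s ^ (a + b))" for x s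
  proof -
    have "(\<Sum>c\<le>2 * N. g c x * s ^ c)
        = (\<Sum>a\<le>N. \<Sum>b\<le>N. \<Sum>c\<le>2 * N. if a + b = c then e a b * x a b * s ^ c else 0)"
      unfolding g_def sum_distrib_right
      by (subst sum.swap, rule sum.cong[OF refl], subst sum.swap)
        (simp add: if_distrib[of "\<lambda>x. x * _"] cong: if_cong)
    also have "\<dots> = (\<Sum>a\<le>N. \<Sum>b\<le>N. e a b * x a b * s ^ (a + b))"
      by (intro sum.cong refl) simp
    finally show ?thesis .
  qed
  have circle: "g c (\<lambda>a b. u ^ a * cnj u ^ b) = 0" if u: "cmod u = 1" and c: "c \<le> 2 * N" for u c
  proof (rule polynomial_zero_if_infinite_roots[where X = "range complex_of_real"])
    show "infinite (range complex_of_real)"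
      using infinite_UNIV_char_0 by (simp add: finite_image_iff inj_on_def)
    fix s assume "s \<in> range complex_of_real"
    then obtain r where s: "s = of_real r" by blast
    have "(\<Sum>a\<le>N. \<Sum>b\<le>N. e a b * (u ^ a * cnj u ^ b) * s ^ (a + b))
        = (\<Sum>a\<le>N. \<Sum>b\<le>N. e a b * (s * u) ^ a * cnj (s * u) ^ b)"
      by (simp add: s power_mult_distrib power_add mult_ac)
    then show "(\<Sum>c\<le>2 * N. g c (\<lambda>a b. u ^ a * cnj u ^ b) * s ^ c) = 0"
      unfolding g zero by simp
  qed (rule c)
  define c where "c = a + b"
  have c: "c \<le> 2 * N" using ab by (simp add: c_def)
  \<comment> \<open>Coefficient of the \<open>x\<close>-th power of \<open>u\<^sup>2\<close>. The
    guard \<open>x \<le> c\<close> is essential, since \<open>c - x\<close> would otherwise truncate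
    to 0.\<close>
  define h where "h x = (if x \<le> c \<and> x \<le> N \<and> c - x \<le> N then e x (c - x) else 0)" for x
  have "(\<Sum>x\<le>N. h x * v ^ x) = 0" if v: "v \<in> (\<lambda>u. u\<^sup>2) ` {u. cmod u = 1}" for v
  proof -
    obtain u where u: "cmod u = 1" "v = u\<^sup>2" using v by blast
    have uu: "u * cnj u = 1" using u(1) by (simp add: complex_norm_square[symmetric])
    have "0 = u ^ c * g c (\<lambda>a b. u ^ a * cnj u ^ b)" using circle[OF u(1) c] by simp
    also have "\<dots> = (\<Sum>x\<le>N. \<Sum>y\<le>N. if x + y = c then e x y * v ^ x else 0)"
    proof -
      have "u ^ (x + y) * (e x y * (u ^ x * cnj u ^ y)) = e x y * v ^ x" for x y
      proof -
        have "u ^ (x + y) * (e x y * (u ^ x * cnj u ^ y)) = e x y * (u ^ x * u ^ x) * (u * cnj u) ^ y"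
          by (simp add: power_add power_mult_distrib mult_ac)
        also have "u ^ x * u ^ x = v ^ x" by (simp add: u(2) power2_eq_square power_mult_distrib)
        finally show ?thesis by (simp add: uu)
      qed
      then show ?thesis
        unfolding g_def sum_distrib_left by (intro sum.cong refl) auto
    qed
    also have "\<dots> = (\<Sum>x\<le>N. h x * v ^ x)"
    proof (intro sum.cong refl)
      fix x
      have "(\<Sum>y\<le>N. if x + y = c then e x y * v ^ x else 0)
          = (\<Sum>y\<le>N. if y = c - x then (if x \<le> c then e x (c - x) * v ^ x else 0) else 0)"
        by (intro sum.cong refl) auto
      then show "(\<Sum>y\<le>N. if x + y = c then e x y * v ^ x else 0) = h x * v ^ x" if "x \<in> {..N}"
        using that by (auto simp: h_def)
    qed
    finally show ?thesis by simp
  qed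
  moreover have "infinite ((\<lambda>u :: complex. u\<^sup>2) ` {u. cmod u = 1})"
  proof -
    have "{u :: complex. cmod u = 1} \<subseteq> (\<lambda>u. u\<^sup>2) ` {u. cmod u = 1}"
    proof
      fix u :: complex assume "u \<in> {u. cmod u = 1}"
      then have "u = (csqrt u)\<^sup>2" "cmod (csqrt u) = 1" by (simp_all add: norm_csqrt)
      then show "u \<in> (\<lambda>u. u\<^sup>2) ` {u. cmod u = 1}" by blast
    qed
    then show ?thesis using infinite_unit_circle infinite_super by blast
  qed
  ultimately have "h a = 0" using polynomial_zero_if_infinite_roots[where n = N and c = h and i = a] ab by blast
  then show ?thesis using ab by (simp add: h_def c_def)
qed

lemma monomial_eval_kronecker:
  assumes "length \<alpha> = n"
  shows "monomial_eval (vec n (\<lambda>i. t ^ b ^ i)) \<alpha> = t ^ code b \<alpha>"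
  using assms unfolding monomial_eval_def horner_sum_eq_sum
  by (simp add: power_mult[symmetric] power_sum atLeast0LessThan mult.commute)

lemma monomial_eval_conjugate:
  assumes "z \<in> carrier_vec n" "length \<alpha> = n"
  shows "monomial_eval (conjugate z) \<alpha> = cnj (monomial_eval z \<alpha>)"
  using assms by (simp add: monomial_eval_def)

lemma monomial_eval_add:
  assumes "length \<alpha> = n" "length \<gamma> = n"
  shows "monomial_eval z (map2 (+) \<alpha> \<gamma>) = monomial_eval z \<alpha> * monomial_eval z \<gamma>"
  using assms by (simp add: monomial_eval_def power_add prod.distrib)

text \<open>Substituting \<open>t ^ b ^ i\<close> for the \<open>i\<close>-th variable, with
  \<open>b\<close> above every exponent in \<open>F\<close>, gives distinct monomials distinct
  powers of \<open>t\<close> and reduces to one variable.\<close>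

lemma coeffs_zero:
  fixes e :: "nat list \<Rightarrow> nat list \<Rightarrow> complex"
  assumes F: "finite F" "F \<subseteq> {\<alpha>. length \<alpha> = n}"
    and zero: "\<And>z. z \<in> carrier_vec n \<Longrightarrow>
      (\<Sum>\<alpha>\<in>F. \<Sum>\<beta>\<in>F. e \<alpha> \<beta> * monomial_eval z \<alpha> * cnj (monomial_eval z \<beta>)) = 0"
    and \<alpha>\<beta>: "\<alpha> \<in> F" "\<beta> \<in> F"
  shows "e \<alpha> \<beta> = 0"
proof -
  define b where "b = Suc (Max (\<Union>(set ` F) \<union> {0}))"
  have b: "x < b" if "\<alpha> \<in> F" "x \<in> set \<alpha>" for \<alpha> x
    unfolding b_def less_Suc_eq_le using F(1) that by (intro Max_ge) auto
  have len: "length \<alpha> = n" if "\<alpha> \<in> F" for \<alpha>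
    using F(2) that by blast
  have inj: "inj_on (code b) F"
  proof (rule inj_onI)
    fix \<alpha> \<beta> assume "\<alpha> \<in> F" "\<beta> \<in> F" "code b \<alpha> = code b \<beta>"
    then show "\<alpha> = \<beta>" using F(2) b by (intro code_inject[of \<alpha> \<beta> b]) auto
  qed
  define N where "N = Max (code b ` F)"
  have N: "code b \<alpha> \<le> N" if "\<alpha> \<in> F" for \<alpha>
    unfolding N_def using F(1) that by simp
  let ?d = "the_inv_into F (code b)"
  define e' where "e' x y = (if x \<in> code b ` F \<and> y \<in> code b ` F then e (?d x) (?d y) else 0)"
    for x y
  have "(\<Sum>x\<le>N. \<Sum>y\<le>N. e' x y * t ^ x * cnj t ^ y) = 0" for t
  proof -
    have "(\<Sum>x\<le>N. \<Sum>y\<le>N. e' x y * t ^ x * cnj t ^ y)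
        = (\<Sum>x\<in>code b ` F. \<Sum>y\<in>code b ` F. e' x y * t ^ x * cnj t ^ y)"
    proof -
      have "(\<Sum>y\<le>N. e' x y * t ^ x * cnj t ^ y) = (\<Sum>y\<in>code b ` F. e' x y * t ^ x * cnj t ^ y)"
        for x by (rule sum.mono_neutral_right) (use N in \<open>auto simp: e'_def\<close>)
      then show ?thesis
        by (simp only:) (rule sum.mono_neutral_right, use N in \<open>auto simp: e'_def\<close>)
    qed
    also have "\<dots> = (\<Sum>\<alpha>\<in>F. \<Sum>\<beta>\<in>F. e \<alpha> \<beta> * t ^ code b \<alpha> * cnj t ^ code b \<beta>)"
      by (simp add: sum.reindex[OF inj] e'_def the_inv_into_f_f[OF inj])
    also have "\<dots> = (\<Sum>\<alpha>\<in>F. \<Sum>\<beta>\<in>F. e \<alpha> \<beta> * monomial_eval (vec n (\<lambda>i. t ^ b ^ i)) \<alpha> *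
        cnj (monomial_eval (vec n (\<lambda>i. t ^ b ^ i)) \<beta>))"
      by (intro sum.cong refl) (simp add: monomial_eval_kronecker len)
    also have "\<dots> = 0" by (rule zero) simp
    finally show ?thesis .
  qed
  from this N[OF \<alpha>\<beta>(1)] N[OF \<alpha>\<beta>(2)] have "e' (code b \<alpha>) (code b \<beta>) = 0"
    by (rule coeffs_zero_single)
  then show ?thesis using \<alpha>\<beta> by (simp add: e'_def the_inv_into_f_f[OF inj])
qed

lemma cmod_square_sum:
  "complex_of_real ((cmod (\<Sum>x\<in>F. p x * y x))\<^sup>2)
    = (\<Sum>\<alpha>\<in>F. \<Sum>\<beta>\<in>F. p \<alpha> * cnj (p \<beta>) * y \<alpha> * cnj (y \<beta>))"
  unfolding complex_norm_square cnj_sum sum_product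
  by (intro sum.cong refl) (simp add: mult_ac)

text \<open>The coefficients of a Hermitian form in \<open>z, z-bar\<close> are determined by its values, so the
  monomials may be replaced by arbitrary numbers.\<close>

lemma hermitian_sum_zero_transfer:
  fixes \<sigma> :: "'l \<Rightarrow> real" and p :: "'l \<Rightarrow> nat list \<Rightarrow> complex"
  assumes F: "finite F" "F \<subseteq> {\<alpha>. length \<alpha> = n}"
    and zero: "\<And>z. z \<in> carrier_vec n \<Longrightarrow>
      (\<Sum>l\<in>L. \<sigma> l * (cmod (\<Sum>\<delta>\<in>F. p l \<delta> * monomial_eval z \<delta>))\<^sup>2) = 0"
  shows "(\<Sum>l\<in>L. \<sigma> l * (cmod (\<Sum>\<delta>\<in>F. p l \<delta> * w \<delta>))\<^sup>2) = 0"
proof -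
  define e where "e \<alpha> \<beta> = (\<Sum>l\<in>L. of_real (\<sigma> l) * (p l \<alpha> * cnj (p l \<beta>)))" for \<alpha> \<beta>
  have expand: "complex_of_real (\<Sum>l\<in>L. \<sigma> l * (cmod (\<Sum>\<delta>\<in>F. p l \<delta> * y \<delta>))\<^sup>2)
      = (\<Sum>\<alpha>\<in>F. \<Sum>\<beta>\<in>F. e \<alpha> \<beta> * y \<alpha> * cnj (y \<beta>))" for y
  proof -
    have "complex_of_real (\<Sum>l\<in>L. \<sigma> l * (cmod (\<Sum>\<delta>\<in>F. p l \<delta> * y \<delta>))\<^sup>2)
        = (\<Sum>l\<in>L. \<Sum>\<alpha>\<in>F. \<Sum>\<beta>\<in>F. of_real (\<sigma> l) * (p l \<alpha> * cnj (p l \<beta>)) * y \<alpha> * cnj (y \<beta>))"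
      unfolding of_real_sum of_real_mult cmod_square_sum sum_distrib_left
      by (simp add: mult.assoc)
    also have "\<dots> = (\<Sum>\<alpha>\<in>F. \<Sum>\<beta>\<in>F. e \<alpha> \<beta> * y \<alpha> * cnj (y \<beta>))"
      unfolding e_def sum_distrib_right
      by (subst sum.swap, rule sum.cong[OF refl], subst sum.swap) simp
    finally show ?thesis .
  qed
  have "e \<alpha> \<beta> = 0" if "\<alpha> \<in> F" "\<beta> \<in> F" for \<alpha> \<beta>
  proof (rule coeffs_zero[OF F _ that])
    fix z :: "complex vec" assume "z \<in> carrier_vec n"
    then show "(\<Sum>\<alpha>\<in>F. \<Sum>\<beta>\<in>F. e \<alpha> \<beta> * monomial_eval z \<alpha> * cnj (monomial_eval z \<beta>)) = 0"
      using expand[of "monomial_eval z"] zero by simp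
  qed
  then have "complex_of_real (\<Sum>l\<in>L. \<sigma> l * (cmod (\<Sum>\<delta>\<in>F. p l \<delta> * w \<delta>))\<^sup>2) = 0"
    unfolding expand by simp
  then show ?thesis by (simp only: of_real_eq_0_iff)
qed

text \<open>The weights built here are the multinomial coefficients; positivity is the property
  passed on.\<close>

lemma sq_norm_power_expansion:
  "\<exists>\<mu>. (\<forall>\<gamma>\<in>mons n d. \<mu> \<gamma> > (0 :: real)) \<and>
    (\<forall>z\<in>carrier_vec n. sq_norm_cvec n z ^ d = (\<Sum>\<gamma>\<in>mons n d. \<mu> \<gamma> * (cmod (monomial_eval z \<gamma>))\<^sup>2))"
proof (induction d)
  case 0
  have "mons n 0 = {replicate n 0}"
    by (auto simp: replicate_eqI sum_list_replicate)
  moreover have "monomial_eval z (replicate n 0) = 1" for z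
    by (simp add: monomial_eval_def)
  ultimately show ?case by (intro exI[of _ "\<lambda>_. 1"]) simp
next
  case (Suc d)
  then obtain \<mu> :: "nat list \<Rightarrow> real" where "\<forall>\<gamma>\<in>mons n d. \<mu> \<gamma> > 0"
    and "\<forall>z\<in>carrier_vec n.
      sq_norm_cvec n z ^ d = (\<Sum>\<gamma>\<in>mons n d. \<mu> \<gamma> * (cmod (monomial_eval z \<gamma>))\<^sup>2)"
    by (elim exE conjE)
  note \<mu> = this[THEN bspec]
  let ?S = "{..<n} \<times> mons n d"
  let ?inc = "\<lambda>(i, \<gamma>). \<gamma>[i := Suc (\<gamma> ! i)] :: nat list"
  \<comment> \<open>The multinomial recurrence: sum over all ways to reach \<open>\<delta>\<close>
    by raising one exponent.\<close>
  define \<nu> where "\<nu> \<delta> = (\<Sum>p\<in>{p \<in> ?S. ?inc p = \<delta>}. \<mu> (snd p))" for \<delta>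
  have "\<nu> \<delta> > 0" if \<delta>: "\<delta> \<in> mons n (Suc d)" for \<delta>
  proof -
    have "sum_list \<delta> \<noteq> 0" using \<delta> by simp
    then obtain x where "x \<in> set \<delta>" "x \<noteq> 0" unfolding sum_list_eq_0_iff by blast
    then obtain i where i: "i < n" "0 < \<delta> ! i"
      using \<delta> by (auto simp: in_set_conv_nth)
    then have "(i, \<delta>[i := \<delta> ! i - 1]) \<in> {p \<in> ?S. ?inc p = \<delta>}"
      using \<delta> sum_list_dec[of i \<delta>] by auto
    then have "{p \<in> ?S. ?inc p = \<delta>} \<noteq> {}" by blast
    moreover have "finite {p \<in> ?S. ?inc p = \<delta>}"
      by (rule finite_subset[of _ ?S]) (blast, intro finite_cartesian_product finite_mons finite_lessThan)
    ultimately show ?thesis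
      unfolding \<nu>_def by (intro sum_pos \<mu>(1)) auto
  qed
  moreover have "sq_norm_cvec n z ^ Suc d = (\<Sum>\<delta>\<in>mons n (Suc d). \<nu> \<delta> * (cmod (monomial_eval z \<delta>))\<^sup>2)"
    if z: "z \<in> carrier_vec n" for z
  proof -
    have mono: "monomial_eval z (\<gamma>[i := Suc (\<gamma> ! i)]) = z $ i * monomial_eval z \<gamma>"
      if "i < n" "length \<gamma> = n" for i \<gamma>
    proof -
      have "monomial_eval z (\<gamma>[i := Suc (\<gamma> ! i)]) =
          z $ i ^ Suc (\<gamma> ! i) * (\<Prod>l\<in>{..<n} - {i}. z $ l ^ \<gamma> ! l)"
        using that by (simp add: monomial_eval_def prod.remove[of _ i] del: power_Suc)
      moreover have "monomial_eval z \<gamma> = z $ i ^ (\<gamma> ! i) * (\<Prod>l\<in>{..<n} - {i}. z $ l ^ \<gamma> ! l)"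
        using that by (simp add: monomial_eval_def prod.remove[of _ i])
      ultimately show ?thesis by simp
    qed
    have "sq_norm_cvec n z ^ Suc d
        = (\<Sum>i<n. \<Sum>\<gamma>\<in>mons n d. (cmod (z $ i))\<^sup>2 * (\<mu> \<gamma> * (cmod (monomial_eval z \<gamma>))\<^sup>2))"
      unfolding power_Suc \<mu>(2)[OF z] unfolding sq_norm_cvec_def sum_product ..
    also have "\<dots> = (\<Sum>p\<in>?S. \<mu> (snd p) * (cmod (monomial_eval z (?inc p)))\<^sup>2)"
      unfolding sum.cartesian_product
      by (intro sum.cong refl) (auto simp: mono norm_mult power_mult_distrib)
    also have "\<dots> = (\<Sum>\<delta>\<in>mons n (Suc d). \<Sum>p\<in>{p \<in> ?S. ?inc p = \<delta>}.
        \<mu> (snd p) * (cmod (monomial_eval z (?inc p)))\<^sup>2)"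
      by (rule sum.group[symmetric]) (auto simp: sum_list_inc)
    also have "\<dots> = (\<Sum>\<delta>\<in>mons n (Suc d). \<nu> \<delta> * (cmod (monomial_eval z \<delta>))\<^sup>2)"
      unfolding \<nu>_def sum_distrib_right by (intro sum.cong refl) auto
    finally show ?thesis .
  qed
  ultimately show ?case by blast
qed

lemma eval_shifted:
  assumes "\<gamma> \<in> mons n d"
  shows "(\<Sum>\<delta>\<in>mons n (m + d). shifted n m u \<gamma> \<delta> * monomial_eval z \<delta>)
    = (\<Sum>\<alpha>\<in>mons n m. u \<alpha> * monomial_eval z \<alpha>) * monomial_eval z \<gamma>"
  unfolding sum_shifted[OF assms] sum_distrib_right
proof (rule sum.cong)
  fix \<alpha> assume "\<alpha> \<in> mons n m"
  then have "monomial_eval z (map2 (+) \<alpha> \<gamma>) = monomial_eval z \<alpha> * monomial_eval z \<gamma>"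
    using assms by (intro monomial_eval_add[of _ n]) simp_all
  then show "u \<alpha> * monomial_eval z (map2 (+) \<alpha> \<gamma>) = u \<alpha> * monomial_eval z \<alpha> * monomial_eval z \<gamma>"
    by (simp only: mult.assoc)
qed simp

text \<open>Pairing the form of degree \<open>m + d\<close> with \<open>w\<close> instead of evaluating it: a squared norm stays
  nonnegative.\<close>

lemma squared_norm_pairing_nonneg:
  assumes J: "finite J"
    and r: "\<And>z. z \<in> carrier_vec n \<Longrightarrow> r z =
      complex_of_real (\<Sum>j\<in>J. ev j * (cmod (\<Sum>\<alpha>\<in>mons n m. u j \<alpha> * monomial_eval z \<alpha>))\<^sup>2)"
    and \<mu>: "\<And>z. z \<in> carrier_vec n \<Longrightarrow>
      sq_norm_cvec n z ^ d = (\<Sum>\<gamma>\<in>mons n d. \<mu> \<gamma> * (cmod (monomial_eval z \<gamma>))\<^sup>2)"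
    and sq: "is_squared_norm n (\<lambda>z. r z * complex_of_real (sq_norm_cvec n z ^ d))"
  shows "0 \<le> (\<Sum>j\<in>J. \<Sum>\<gamma>\<in>mons n d. ev j * \<mu> \<gamma> *
    (cmod (\<Sum>\<delta>\<in>mons n (m + d). shifted n m (u j) \<gamma> \<delta> * w \<delta>))\<^sup>2)"
proof -
  let ?S = "mons n (m + d)"
  obtain K :: nat and h where h: "\<And>k. k < K \<Longrightarrow> holomorphic_polynomial n (h k)"
    and eq: "\<And>z. z \<in> carrier_vec n \<Longrightarrow>
      r z * complex_of_real (sq_norm_cvec n z ^ d) = complex_of_real (\<Sum>k<K. (cmod (h k z))\<^sup>2)"
    using sq unfolding is_squared_norm_def by blast
  have "\<forall>k\<in>{..<K}. \<exists>Aa. finite (fst Aa) \<and> fst Aa \<subseteq> {\<alpha>. length \<alpha> = n} \<and>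
      (\<forall>z\<in>carrier_vec n. h k z = (\<Sum>\<alpha>\<in>fst Aa. snd Aa \<alpha> * monomial_eval z \<alpha>))"
    using h by (auto simp: holomorphic_polynomial_def)
  then obtain Aa where Aa: "\<forall>k\<in>{..<K}. finite (fst (Aa k)) \<and> fst (Aa k) \<subseteq> {\<alpha>. length \<alpha> = n} \<and>
      (\<forall>z\<in>carrier_vec n. h k z = (\<Sum>\<alpha>\<in>fst (Aa k). snd (Aa k) \<alpha> * monomial_eval z \<alpha>))"
    by (rule bchoice[THEN exE])
  \<comment> \<open>The components of \<open>h\<close> may contain monomials of any degree, so both
    sides are put on one common finite support.\<close>
  define F where "F = ?S \<union> (\<Union>k<K. fst (Aa k))"
  have F: "finite F" "F \<subseteq> {\<alpha>. length \<alpha> = n}" using Aa by (auto simp: F_def)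
  define p where "p l \<delta> = (case l of
      Inl (j, \<gamma>) \<Rightarrow> if \<delta> \<in> ?S then shifted n m (u j) \<gamma> \<delta> else 0
    | Inr k \<Rightarrow> if \<delta> \<in> fst (Aa k) then snd (Aa k) \<delta> else 0)" for l \<delta>
  \<comment> \<open>Weight -1 on the squares from \<open>h\<close> turns the assumed identity into
    the vanishing of one Hermitian sum.\<close>
  define \<sigma> where "\<sigma> l = (case l of Inl (j, \<gamma>) \<Rightarrow> ev j * \<mu> \<gamma> | Inr (k :: nat) \<Rightarrow> - 1)" for l
  let ?L = "(J \<times> mons n d) <+> {..<K}"
  have pl: "(\<Sum>\<delta>\<in>F. p (Inl (j, \<gamma>)) \<delta> * y \<delta>) = (\<Sum>\<delta>\<in>?S. shifted n m (u j) \<gamma> \<delta> * y \<delta>)" for j \<gamma> y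
    using F(1) by (intro sum.mono_neutral_cong_right) (auto simp: p_def F_def)
  have pr: "(\<Sum>\<delta>\<in>F. p (Inr k) \<delta> * y \<delta>) = (\<Sum>\<delta>\<in>fst (Aa k). snd (Aa k) \<delta> * y \<delta>)" if "k < K" for k y
    using F(1) that by (intro sum.mono_neutral_cong_right) (auto simp: p_def F_def)
  have split: "(\<Sum>l\<in>?L. \<sigma> l * (cmod (\<Sum>\<delta>\<in>F. p l \<delta> * y \<delta>))\<^sup>2)
      = (\<Sum>j\<in>J. \<Sum>\<gamma>\<in>mons n d. ev j * \<mu> \<gamma> * (cmod (\<Sum>\<delta>\<in>?S. shifted n m (u j) \<gamma> \<delta> * y \<delta>))\<^sup>2)
        - (\<Sum>k<K. (cmod (\<Sum>\<delta>\<in>fst (Aa k). snd (Aa k) \<delta> * y \<delta>))\<^sup>2)" for y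
  proof -
    have "(\<Sum>l\<in>?L. \<sigma> l * (cmod (\<Sum>\<delta>\<in>F. p l \<delta> * y \<delta>))\<^sup>2)
        = (\<Sum>q\<in>J \<times> mons n d. \<sigma> (Inl q) * (cmod (\<Sum>\<delta>\<in>F. p (Inl q) \<delta> * y \<delta>))\<^sup>2)
          + (\<Sum>k<K. \<sigma> (Inr k) * (cmod (\<Sum>\<delta>\<in>F. p (Inr k) \<delta> * y \<delta>))\<^sup>2)"
      using J by (subst sum.Plus) simp_all
    moreover have "(\<Sum>q\<in>J \<times> mons n d. \<sigma> (Inl q) * (cmod (\<Sum>\<delta>\<in>F. p (Inl q) \<delta> * y \<delta>))\<^sup>2)
        = (\<Sum>j\<in>J. \<Sum>\<gamma>\<in>mons n d. ev j * \<mu> \<gamma> * (cmod (\<Sum>\<delta>\<in>?S. shifted n m (u j) \<gamma> \<delta> * y \<delta>))\<^sup>2)"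
      unfolding sum.cartesian_product by (intro sum.cong refl) (auto simp: pl \<sigma>_def)
    moreover have "(\<Sum>k<K. \<sigma> (Inr k) * (cmod (\<Sum>\<delta>\<in>F. p (Inr k) \<delta> * y \<delta>))\<^sup>2)
        = - (\<Sum>k<K. (cmod (\<Sum>\<delta>\<in>fst (Aa k). snd (Aa k) \<delta> * y \<delta>))\<^sup>2)"
      unfolding sum_negf[symmetric] by (intro sum.cong refl) (simp add: pr \<sigma>_def)
    ultimately show ?thesis by simp
  qed
  have "(\<Sum>l\<in>?L. \<sigma> l * (cmod (\<Sum>\<delta>\<in>F. p l \<delta> * w \<delta>))\<^sup>2) = 0"
  proof (rule hermitian_sum_zero_transfer[OF F])
    fix z :: "complex vec" assume z: "z \<in> carrier_vec n"
    let ?q = "\<lambda>j. \<Sum>\<alpha>\<in>mons n m. u j \<alpha> * monomial_eval z \<alpha>"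
    have "(\<Sum>j\<in>J. \<Sum>\<gamma>\<in>mons n d. ev j * \<mu> \<gamma> *
          (cmod (\<Sum>\<delta>\<in>?S. shifted n m (u j) \<gamma> \<delta> * monomial_eval z \<delta>))\<^sup>2)
        = (\<Sum>j\<in>J. ev j * (cmod (?q j))\<^sup>2) * sq_norm_cvec n z ^ d"
      unfolding \<mu>[OF z] sum_product
      by (intro sum.cong refl) (simp add: eval_shifted norm_mult power_mult_distrib)
    moreover have "(\<Sum>k<K. (cmod (\<Sum>\<delta>\<in>fst (Aa k). snd (Aa k) \<delta> * monomial_eval z \<delta>))\<^sup>2)
        = (\<Sum>k<K. (cmod (h k z))\<^sup>2)"
      using Aa z by (intro sum.cong refl) auto
    moreover have "complex_of_real ((\<Sum>j\<in>J. ev j * (cmod (?q j))\<^sup>2) * sq_norm_cvec n z ^ d)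
        = complex_of_real (\<Sum>k<K. (cmod (h k z))\<^sup>2)"
      using eq[OF z] r[OF z] by simp
    then have "(\<Sum>j\<in>J. ev j * (cmod (?q j))\<^sup>2) * sq_norm_cvec n z ^ d = (\<Sum>k<K. (cmod (h k z))\<^sup>2)"
      by (simp only: of_real_eq_iff)
    ultimately show "(\<Sum>l\<in>?L. \<sigma> l * (cmod (\<Sum>\<delta>\<in>F. p l \<delta> * monomial_eval z \<delta>))\<^sup>2) = 0"
      unfolding split by simp
  qed
  then show ?thesis unfolding split by (simp add: sum_nonneg)
qed


section \<open>Diagonalization of Hermitian matrices\<close>

definition adj :: "complex mat \<Rightarrow> complex mat" where
  "adj A = mat (dim_col A) (dim_row A) (\<lambda>(i, j). cnj (A $$ (j, i)))"

definition real_diag :: "nat \<Rightarrow> (nat \<Rightarrow> real) \<Rightarrow> complex mat" where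
  "real_diag N ev = mat N N (\<lambda>(i, j). if i = j then of_real (ev i) else 0)"

lemma adj_dim [simp]: "dim_row (adj A) = dim_col A" "dim_col (adj A) = dim_row A"
  by (simp_all add: adj_def)

lemma adj_carrier [simp]: "A \<in> carrier_mat n m \<Longrightarrow> adj A \<in> carrier_mat m n"
  by (intro carrier_matI) (simp_all add: carrier_matD)

lemma adj_index [simp]: "i < dim_col A \<Longrightarrow> j < dim_row A \<Longrightarrow> adj A $$ (i, j) = cnj (A $$ (j, i))"
  by (simp add: adj_def)

lemma real_diag_carrier [simp]: "real_diag N ev \<in> carrier_mat N N"
  by (simp add: real_diag_def)

lemma mat_mult_entry:
  assumes "A \<in> carrier_mat n m" "B \<in> carrier_mat m k" "i < n" "j < k"
  shows "(A * B) $$ (i, j) = (\<Sum>l<m. A $$ (i, l) * B $$ (l, j))"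
  using assms by (auto simp: scalar_prod_def atLeast0LessThan intro!: sum.cong)

lemma adj_mult:
  assumes "A \<in> carrier_mat n m" "B \<in> carrier_mat m k"
  shows "adj (A * B) = adj B * adj A"
  using assms by (intro eq_matI) (auto simp: scalar_prod_def mult.commute)

lemma adj_adj [simp]: "adj (adj A) = A"
  unfolding adj_def by (rule eq_matI) simp_all

lemma cscalar_prod_sum:
  fixes v w :: "complex vec"
  assumes "w \<in> carrier_vec n"
  shows "v \<bullet>c w = (\<Sum>i<n. v $ i * cnj (w $ i))"
  using assms by (simp add: scalar_prod_def atLeast0LessThan)

text \<open>Gram-Schmidt on a basis completion of \<open>v\<close> keeps \<open>v\<close> in front
  but gives merely orthogonal vectors; the columns are normalized afterwards and \<open>s\<close> is
  the inverse length of \<open>v\<close>.\<close>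

lemma unitary_with_first_column:
  fixes v :: "complex vec"
  assumes v: "v \<in> carrier_vec n" "v \<noteq> 0\<^sub>v n"
  shows "\<exists>W s. W \<in> carrier_mat n n \<and> adj W * W = 1\<^sub>m n \<and> (\<forall>i<n. W $$ (i, 0) = s * v $ i)"
proof -
  interpret cof_vec_space n "TYPE(complex)" .
  define b where "b = basis_completion v"
  define ws where "ws = gram_schmidt n b"
  note bc = basis_completion[OF v, folded b_def]
  have n: "n \<noteq> 0" using v by auto
  obtain vs where bv: "b = v # vs" using bc n by (cases b) auto
  have ws: "set ws \<subseteq> carrier_vec n" "corthogonal ws" "length ws = n"
    using gram_schmidt_result[of b ws] bc by (auto simp: ws_def)
  have "hd ws = v" unfolding ws_def bv by (rule gram_schmidt_hd[OF v(1)])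
  then have ws0: "ws ! 0 = v" using ws n by (cases ws) auto
  have car: "ws ! j \<in> carrier_vec n" if "j < n" for j using ws that by auto
  define sq where "sq j = (\<Sum>i<n. (cmod (ws ! j $ i))\<^sup>2)" for j
  have orth: "(\<Sum>i<n. ws ! j $ i * cnj (ws ! k $ i)) = (if j = k then of_real (sq j) else 0)"
    "0 < sq j" if "j < n" "k < n" for j k
  proof -
    have diag: "(\<Sum>i<n. ws ! j $ i * cnj (ws ! j $ i)) = of_real (sq j)"
      unfolding sq_def of_real_sum by (rule sum.cong) (simp_all only: complex_norm_square)
    have "(\<Sum>i<n. ws ! j $ i * cnj (ws ! k $ i)) = 0 \<longleftrightarrow> j \<noteq> k" if "k < n" for k
      using corthogonalD[OF ws(2), of j k] cscalar_prod_sum[OF car] \<open>j < n\<close> that ws(3) by simp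
    from this[OF that(2)] this[OF that(1)]
    have zero: "(\<Sum>i<n. ws ! j $ i * cnj (ws ! k $ i)) = 0 \<longleftrightarrow> j \<noteq> k" and "complex_of_real (sq j) \<noteq> 0"
      unfolding diag by simp_all
    then have "sq j \<noteq> 0" by simp
    moreover have "0 \<le> sq j" unfolding sq_def by (intro sum_nonneg) simp
    ultimately show "0 < sq j" by simp
    show "(\<Sum>i<n. ws ! j $ i * cnj (ws ! k $ i)) = (if j = k then of_real (sq j) else 0)"
      using zero diag by (cases "j = k") simp_all
  qed
  define W where "W = mat n n (\<lambda>(i, j). ws ! j $ i / of_real (sqrt (sq j)))"
  have W: "W \<in> carrier_mat n n" by (simp add: W_def)
  have "adj W * W = 1\<^sub>m n"
  proof (rule eq_matI)
    fix j k assume "j < dim_row (1\<^sub>m n)" "k < dim_col (1\<^sub>m n)"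
    then have jk: "j < n" "k < n" by simp_all
    have "(adj W * W) $$ (j, k) = (\<Sum>i<n. cnj (ws ! j $ i / of_real (sqrt (sq j))) *
        (ws ! k $ i / of_real (sqrt (sq k))))"
      using jk by (simp add: scalar_prod_def W_def atLeast0LessThan)
    also have "\<dots> = (\<Sum>i<n. ws ! k $ i * cnj (ws ! j $ i)) / (of_real (sqrt (sq j)) * of_real (sqrt (sq k)))"
      by (simp add: sum_divide_distrib mult.commute)
    also have "\<dots> = 1\<^sub>m n $$ (j, k)"
      using orth[of k j] jk by (simp flip: of_real_mult)
    finally show "(adj W * W) $$ (j, k) = 1\<^sub>m n $$ (j, k)" .
  qed (use W in auto)
  moreover have "\<forall>i<n. W $$ (i, 0) = (1 / of_real (sqrt (sq 0))) * v $ i"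
    using n by (simp add: W_def ws0)
  ultimately show ?thesis using W by blast
qed

lemma eigenvalue_exists:
  fixes A :: "complex mat"
  assumes "A \<in> carrier_mat n n" "n > 0"
  shows "\<exists>e. eigenvalue A e"
proof -
  have "degree (char_poly A) = n" using degree_monic_char_poly[OF assms(1)] by blast
  then have "\<not> constant (poly (char_poly A))" using assms(2) by (simp add: constant_degree)
  then show ?thesis
    using fundamental_theorem_of_algebra eigenvalue_root_char_poly[OF assms(1)] by blast
qed

text \<open>Deflation: in a unitary basis starting with an eigenvector the first column is
  \<open>e\<close> followed by zeros, and Hermitian symmetry clears the first row too, leaving a
  smaller Hermitian block.\<close>

theorem hermitian_diagonalization:
  assumes "A \<in> carrier_mat N N" "adj A = A"
  shows "\<exists>U ev. U \<in> carrier_mat N N \<and> adj U * U = 1\<^sub>m N \<and> A = U * real_diag N ev * adj U"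
  using assms
proof (induction N arbitrary: A)
  case 0
  then have "A = 1\<^sub>m 0 * real_diag 0 (\<lambda>_. 0) * adj (1\<^sub>m 0)" "adj (1\<^sub>m 0) * 1\<^sub>m 0 = 1\<^sub>m 0"
    by (auto intro!: eq_matI)
  then show ?case by (intro exI[of _ "1\<^sub>m 0"] exI[of _ "\<lambda>_. 0"]) simp
next
  case (Suc N)
  let ?n = "Suc N"
  note A = Suc.prems(1)
  obtain e where "eigenvalue A e" using eigenvalue_exists[OF A] by blast
  then obtain v where v: "v \<in> carrier_vec ?n" "v \<noteq> 0\<^sub>v ?n" "A *\<^sub>v v = e \<cdot>\<^sub>v v"
    using A unfolding eigenvalue_def eigenvector_def by auto
  obtain W s where W: "W \<in> carrier_mat ?n ?n" "adj W * W = 1\<^sub>m ?n"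
    and W0: "\<And>i. i < ?n \<Longrightarrow> W $$ (i, 0) = s * v $ i"
    using unitary_with_first_column[OF v(1,2)] by blast
  have WW: "W * adj W = 1\<^sub>m ?n" using mat_mult_left_right_inverse[OF _ W(1) W(2)] W(1) by simp
  define B where "B = adj W * (A * W)"
  have aW: "adj W \<in> carrier_mat ?n ?n" using W by simp
  have B: "B \<in> carrier_mat ?n ?n"
    unfolding B_def by (rule mult_carrier_mat[OF aW mult_carrier_mat[OF A W(1)]])
  have adjB: "adj B = B"
    unfolding B_def using adj_mult[of "adj W" ?n ?n "A * W" ?n] adj_mult[OF A W(1)] aW W A Suc.prems(2)
    by (simp add: assoc_mult_mat[OF aW A W(1)])
  have AW0: "(A * W) $$ (i, 0) = e * W $$ (i, 0)" if i: "i < ?n" for i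
  proof -
    have "(A * W) $$ (i, 0) = (\<Sum>k<?n. A $$ (i, k) * W $$ (k, 0))"
      using i by (intro mat_mult_entry[OF A W(1)]) simp_all
    also have "\<dots> = s * (\<Sum>k<?n. A $$ (i, k) * v $ k)"
      unfolding sum_distrib_left by (intro sum.cong refl) (simp add: W0)
    also have "(\<Sum>k<?n. A $$ (i, k) * v $ k) = (A *\<^sub>v v) $ i"
      using A v(1) i by (simp add: scalar_prod_def atLeast0LessThan del: sum.lessThan_Suc sum.op_ivl_Suc)
    also have "\<dots> = e * v $ i" using v i by simp
    finally show ?thesis using W0[OF i] by simp
  qed
  have B0: "B $$ (i, 0) = (if i = 0 then e else 0)" if i: "i < ?n" for i
  proof -
    have "B $$ (i, 0) = (\<Sum>k<?n. adj W $$ (i, k) * (A * W) $$ (k, 0))"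
      unfolding B_def using i by (intro mat_mult_entry[OF aW mult_carrier_mat[OF A W(1)]]) simp_all
    also have "\<dots> = e * (\<Sum>k<?n. adj W $$ (i, k) * W $$ (k, 0))"
      unfolding sum_distrib_left by (intro sum.cong refl) (simp add: AW0)
    also have "(\<Sum>k<?n. adj W $$ (i, k) * W $$ (k, 0)) = (adj W * W) $$ (i, 0)"
      using i by (intro mat_mult_entry[OF aW W(1), symmetric]) simp_all
    also have "\<dots> = (if i = 0 then 1 else 0)" using W(2) i by simp
    finally show ?thesis by simp
  qed
  have Bsym: "B $$ (i, j) = cnj (B $$ (j, i))" if "i < ?n" "j < ?n" for i j
    using arg_cong[OF adjB, of "\<lambda>X. X $$ (i, j)"] that B by simp
  have B0_row: "B $$ (0, j) = 0" if "0 < j" "j < ?n" for j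
    using that by (subst Bsym) (simp_all add: B0)
  have "B $$ (0, 0) = e" using B0[of 0] by simp
  \<comment> \<open>\<open>e\<close> is a diagonal entry of a Hermitian matrix, hence real.\<close>
  with Bsym[OF zero_less_Suc zero_less_Suc] have "cnj e = e" by metis
  then have e: "of_real (Re e) = e" by (metis Reals_cnj_iff of_real_Re)
  define A3 where "A3 = mat N N (\<lambda>(i, j). B $$ (Suc i, Suc j))"
  have "adj A3 = A3"
  proof (rule eq_matI)
    fix i j assume "i < dim_row A3" "j < dim_col A3"
    then have ij: "i < N" "j < N" by (simp_all add: A3_def)
    then have "adj A3 $$ (i, j) = cnj (B $$ (Suc j, Suc i))" by (simp add: A3_def)
    also have "\<dots> = B $$ (Suc i, Suc j)" using ij by (intro Bsym[symmetric]) simp_all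
    finally show "adj A3 $$ (i, j) = A3 $$ (i, j)" using ij by (simp add: A3_def)
  qed (simp_all add: A3_def)
  then obtain U3 ev where U3: "U3 \<in> carrier_mat N N" "adj U3 * U3 = 1\<^sub>m N"
    and A3: "A3 = U3 * real_diag N ev * adj U3"
    using Suc.IH[of A3] by (auto simp: A3_def)
  define U' where "U' = four_block_mat (1\<^sub>m 1) (0\<^sub>m 1 N) (0\<^sub>m N 1) U3"
  let ?E = "mat 1 1 (\<lambda>_. e)"
  let ?D = "four_block_mat ?E (0\<^sub>m 1 N) (0\<^sub>m N 1) (real_diag N ev)"
  let ?aU = "four_block_mat (1\<^sub>m 1) (0\<^sub>m 1 N) (0\<^sub>m N 1) (adj U3)"
  have aU': "adj U' = ?aU"
    unfolding U'_def using U3(1) by (intro eq_matI) auto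
  have D: "?D = real_diag ?n (case_nat (Re e) ev)"
    by (intro eq_matI) (auto simp: real_diag_def e split: nat.split)
  have Bblock: "B = four_block_mat ?E (0\<^sub>m 1 N) (0\<^sub>m N 1) A3"
  proof (rule eq_matI)
    fix i j assume "i < dim_row (four_block_mat ?E (0\<^sub>m 1 N) (0\<^sub>m N 1) A3)"
      "j < dim_col (four_block_mat ?E (0\<^sub>m 1 N) (0\<^sub>m N 1) A3)"
    then have ij: "i < ?n" "j < ?n" by (simp_all add: A3_def)
    then show "B $$ (i, j) = four_block_mat ?E (0\<^sub>m 1 N) (0\<^sub>m N 1) A3 $$ (i, j)"
      using B0[of i] B0_row[of j] by (cases i; cases j) (auto simp: A3_def)
  qed (use B in \<open>auto simp: A3_def\<close>)
  have U': "U' \<in> carrier_mat ?n ?n" 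
    using four_block_carrier_mat[OF one_carrier_mat[of 1] U3(1), of "0\<^sub>m 1 N" "0\<^sub>m N 1"]
    by (simp add: U'_def)
  have car: "1\<^sub>m 1 \<in> carrier_mat 1 1" "0\<^sub>m 1 N \<in> carrier_mat 1 N" "0\<^sub>m N 1 \<in> carrier_mat N 1"
    "?E \<in> carrier_mat 1 1" "adj U3 \<in> carrier_mat N N" "real_diag N ev \<in> carrier_mat N N"
    using U3 by simp_all
  have UU': "adj U' * U' = 1\<^sub>m ?n"
  proof -
    have "adj U' * U' = four_block_mat (1\<^sub>m 1) (0\<^sub>m 1 N) (0\<^sub>m N 1) (1\<^sub>m N)"
      unfolding aU' unfolding U'_def using U3 car
      by (subst mult_four_block_mat[of _ 1 1 _ N _ N _ _ 1 _ N]) simp_all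
    also have "\<dots> = 1\<^sub>m ?n" by (intro eq_matI) auto
    finally show ?thesis .
  qed
  have "U' * ?D * adj U' = B"
  proof -
    have UD: "U3 * real_diag N ev \<in> carrier_mat N N" by (rule mult_carrier_mat[OF U3(1) car(6)])
    have "U' * ?D = four_block_mat ?E (0\<^sub>m 1 N) (0\<^sub>m N 1) (U3 * real_diag N ev)"
      unfolding U'_def using U3 car
      by (subst mult_four_block_mat[of _ 1 1 _ N _ N _ _ 1 _ N])
        (simp_all add: left_mult_zero_mat[OF car(6)])
    then have "U' * ?D * adj U' = four_block_mat ?E (0\<^sub>m 1 N) (0\<^sub>m N 1) (U3 * real_diag N ev * adj U3)"
      unfolding aU' using U3 car UD
      by (simp only:) (subst mult_four_block_mat[of _ 1 1 _ N _ N _ _ 1 _ N],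
        simp_all add: right_mult_zero_mat[OF UD] left_add_zero_mat[OF mult_carrier_mat[OF UD car(5)]])
    then show ?thesis unfolding Bblock A3 .
  qed
  then have B': "U' * real_diag ?n (case_nat (Re e) ev) * adj U' = B" unfolding D .
  have aU'c: "adj U' \<in> carrier_mat ?n ?n" using U' by simp
  let ?R = "real_diag ?n (case_nat (Re e) ev)"
  note assoc = assoc_mult_mat[of _ ?n ?n _ ?n _ ?n] mult_carrier_mat[of _ ?n ?n _ ?n]
  have adjWU: "adj (W * U') = adj U' * adj W" by (rule adj_mult[OF W(1) U'])
  have "adj (W * U') * (W * U') = adj U' * ((adj W * W) * U')"
    unfolding adjWU using W(1) aW U' aU'c by (simp add: assoc)
  also have "\<dots> = 1\<^sub>m ?n" unfolding W(2) using U' UU' by simp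
  finally have 1: "adj (W * U') * (W * U') = 1\<^sub>m ?n" .
  have "W * U' * ?R * adj (W * U') = W * (U' * ?R * adj U') * adj W"
    unfolding adjWU using W(1) aW U' aU'c by (simp add: assoc)
  also have "\<dots> = (W * adj W) * A * (W * adj W)"
    unfolding B' unfolding B_def using W(1) aW A by (simp add: assoc)
  also have "\<dots> = A" unfolding WW using A by simp
  finally have "A = W * U' * ?R * adj (W * U')" ..
  then show ?case using 1 mult_carrier_mat[OF W(1) U'] by blast
qed

section \<open>Eigenvalue counts and the signature\<close>

lemma order_prod_linear:
  fixes ev :: "nat \<Rightarrow> 'a :: field"
  shows "Polynomial.order x (\<Prod>j<N. [:- ev j, 1:]) = card {j. j < N \<and> ev j = x}"
proof (induction N)
  case (Suc N)
  have ne: "(\<Prod>j<N. [:- ev j, 1:]) * [:- ev N, 1:] \<noteq> 0"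
    by (intro no_zero_divisors) (simp_all add: prod_zero_iff)
  have "Polynomial.order x (\<Prod>j<Suc N. [:- ev j, 1:])
      = card {j. j < N \<and> ev j = x} + Polynomial.order x [:- ev N, 1:]"
    unfolding prod.lessThan_Suc order_mult[OF ne] Suc ..
  also have "Polynomial.order x [:- ev N, 1:] = (if ev N = x then 1 else 0)"
    using order_linear[of "ev N"] by (auto intro!: order_0I)
  also have "card {j. j < N \<and> ev j = x} + (if ev N = x then 1 else 0) = card {j. j < Suc N \<and> ev j = x}"
  proof (cases "ev N = x")
    case True
    then have "{j. j < Suc N \<and> ev j = x} = insert N {j. j < N \<and> ev j = x}" by auto
    then show ?thesis using True by simp
  next
    case False
    then have "{j. j < Suc N \<and> ev j = x} = {j. j < N \<and> ev j = x}" using less_Suc_eq by auto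
    then show ?thesis using False by simp
  qed
  finally show ?case .
qed simp

lemma char_poly_diagonalized:
  assumes "U \<in> carrier_mat N N" "adj U * U = 1\<^sub>m N" "A = U * real_diag N ev * adj U"
  shows "char_poly A = (\<Prod>j<N. [:- complex_of_real (ev j), 1:])"
proof -
  have aU: "adj U \<in> carrier_mat N N" using assms by simp
  have UU: "U * adj U = 1\<^sub>m N" using mat_mult_left_right_inverse[OF aU assms(1,2)] .
  have "similar_mat_wit A (real_diag N ev) U (adj U)"
    using assms aU UU by (intro similar_mat_witI[of _ _ N]) auto
  then have "char_poly A = char_poly (real_diag N ev)"
    by (intro char_poly_similar) (auto simp: similar_mat_def)
  also have "\<dots> = (\<Prod>a\<leftarrow>diag_mat (real_diag N ev). [:- a, 1:])"
    by (rule char_poly_upper_triangular[of _ N]) (auto simp: real_diag_def)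
  also have "diag_mat (real_diag N ev) = map (\<lambda>j. complex_of_real (ev j)) [0..<N]"
    by (simp add: diag_mat_def real_diag_def)
  finally show ?thesis
    by (simp add: prod.list_conv_set_nth atLeast0LessThan o_def)
qed

lemma eigenvalue_count:
  assumes "A \<in> carrier_mat N N" "char_poly A = (\<Prod>j<N. [:- complex_of_real (ev j), 1:])"
  shows "(\<Sum>x\<in>{x. P x \<and> eigenvalue A (complex_of_real x)}.
    Polynomial.order (complex_of_real x) (char_poly A)) = card {j. j < N \<and> P (ev j)}"
proof -
  have "eigenvalue A (complex_of_real x) \<longleftrightarrow> x \<in> ev ` {..<N}" for x
    unfolding eigenvalue_root_char_poly[OF assms(1)] assms(2) poly_prod
    by (auto simp: prod_zero_iff)
  then have ev: "{x. P x \<and> eigenvalue A (complex_of_real x)} = ev ` {j. j < N \<and> P (ev j)}"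
    by auto
  have "(\<Sum>x\<in>ev ` {j. j < N \<and> P (ev j)}. Polynomial.order (complex_of_real x) (char_poly A))
      = (\<Sum>x\<in>ev ` {j. j < N \<and> P (ev j)}. \<Sum>j\<in>{j \<in> {j. j < N \<and> P (ev j)}. ev j = x}. 1)"
    unfolding assms(2) order_prod_linear
    by (intro sum.cong refl) (auto intro!: arg_cong[where f = card])
  also have "\<dots> = (\<Sum>j\<in>{j. j < N \<and> P (ev j)}. 1)"
    by (rule sum.group) auto
  finally show ?thesis unfolding ev by simp
qed

text \<open>The form \<open>u j\<close> has the \<open>j\<close>-th column of the diagonalizing
  unitary matrix as coefficients. The last property says that these columns span: it follows from
  \<open>U * adj U = 1\<close>, although the pairing with \<open>w\<close> is bilinear.\<close>

lemma hermitian_coeffs_decomposition: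
  assumes n: "n \<ge> 1" and herm: "hermitian_coeffs n m c" and sig: "signature_pair n m c = (P, N)"
  obtains ev :: "nat \<Rightarrow> real" and u :: "nat \<Rightarrow> nat list \<Rightarrow> complex"
  where "P = card {j. j < D n m \<and> 0 < ev j}" "N = card {j. j < D n m \<and> ev j < 0}"
    "\<And>\<alpha> \<beta>. \<alpha> \<in> mons n m \<Longrightarrow> \<beta> \<in> mons n m \<Longrightarrow>
      c \<alpha> \<beta> = (\<Sum>j<D n m. of_real (ev j) * (u j \<alpha> * cnj (u j \<beta>)))"
    "\<And>w \<alpha>. (\<forall>j<D n m. (\<Sum>\<alpha>\<in>mons n m. u j \<alpha> * w \<alpha>) = 0) \<Longrightarrow> \<alpha> \<in> mons n m \<Longrightarrow> w \<alpha> = 0"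
proof -
  let ?L = "D n m"
  define ms where "ms = multi_indices n m"
  have ms: "length ms = ?L" "set ms = mons n m" "distinct ms"
    using n by (simp_all add: ms_def length_multi_indices set_multi_indices distinct_multi_indices)
  define A where "A = coeff_mat n m c"
  have A: "A \<in> carrier_mat ?L ?L"
    using ms by (simp add: A_def coeff_mat_def ms_def Let_def)
  have Aij: "A $$ (i, k) = c (ms ! i) (ms ! k)" if "i < ?L" "k < ?L" for i k
    using that ms by (simp add: A_def coeff_mat_def ms_def Let_def)
  have msin: "ms ! i \<in> set ms" if "i < ?L" for i using ms that by (metis nth_mem)
  have "adj A = A"
  proof (rule eq_matI)
    fix i k assume "i < dim_row A" "k < dim_col A"
    then have ik: "i < ?L" "k < ?L" using A by auto
    have "c (ms ! i) (ms ! k) = cnj (c (ms ! k) (ms ! i))"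
      using herm[unfolded hermitian_coeffs_def, folded ms_def] msin ik by blast
    then show "adj A $$ (i, k) = A $$ (i, k)" using A ik by (simp add: Aij)
  qed (use A in auto)
  from hermitian_diagonalization[OF A this] obtain U ev
    where U: "U \<in> carrier_mat ?L ?L" "adj U * U = 1\<^sub>m ?L" "A = U * real_diag ?L ev * adj U"
    by blast
  have cp: "char_poly A = (\<Prod>j<?L. [:- complex_of_real (ev j), 1:])"
    by (rule char_poly_diagonalized[OF U])
  have "P = num_pos_eigenvalues A" "N = num_neg_eigenvalues A"
    using sig by (simp_all add: signature_pair_def A_def)
  then have P: "P = card {j. j < ?L \<and> 0 < ev j}" and N: "N = card {j. j < ?L \<and> ev j < 0}"
    using eigenvalue_count[OF A cp, of "\<lambda>x. x > 0"] eigenvalue_count[OF A cp, of "\<lambda>x. x < 0"]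
    by (simp_all add: num_pos_eigenvalues_def num_neg_eigenvalues_def)
  define idx where "idx = the_inv_into {..<?L} ((!) ms)"
  have bij: "bij_betw ((!) ms) {..<?L} (mons n m)"
    using bij_betw_nth[OF ms(3)] ms by simp
  have idx: "idx (ms ! i) = i" if "i < ?L" for i
    unfolding idx_def using bij that by (intro the_inv_into_f_f) (auto simp: bij_betw_def)
  have surj: "\<exists>i<?L. \<alpha> = ms ! i" if "\<alpha> \<in> mons n m" for \<alpha>
  proof -
    have "\<alpha> \<in> (!) ms ` {..<?L}" unfolding bij_betw_imp_surj_on[OF bij] by (rule that)
    then show ?thesis by blast
  qed
  define u where "u j \<alpha> = U $$ (idx \<alpha>, j)" for j \<alpha>
  have UU: "U * adj U = 1\<^sub>m ?L"
    using mat_mult_left_right_inverse[OF adj_carrier[OF U(1)] U(1,2)] .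
  have c: "c \<alpha> \<beta> = (\<Sum>j<?L. of_real (ev j) * (u j \<alpha> * cnj (u j \<beta>)))"
    if \<alpha>\<beta>: "\<alpha> \<in> mons n m" "\<beta> \<in> mons n m" for \<alpha> \<beta>
  proof -
    obtain i k where ik: "i < ?L" "k < ?L" "\<alpha> = ms ! i" "\<beta> = ms ! k"
      using surj[OF \<alpha>\<beta>(1)] surj[OF \<alpha>\<beta>(2)] by blast
    have UD: "(U * real_diag ?L ev) $$ (i, j) = U $$ (i, j) * of_real (ev j)" if "j < ?L" for j
    proof -
      have "(U * real_diag ?L ev) $$ (i, j)
          = (\<Sum>l<?L. U $$ (i, l) * (if l = j then of_real (ev l) else 0))"
        using U(1) ik that by (simp add: scalar_prod_def real_diag_def atLeast0LessThan)
      also have "\<dots> = U $$ (i, j) * of_real (ev j)"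
        using that by (simp add: if_distrib[of "\<lambda>x. _ * x"] cong: if_cong)
      finally show ?thesis .
    qed
    have "c \<alpha> \<beta> = (U * real_diag ?L ev * adj U) $$ (i, k)"
      using Aij ik U(3) by simp
    also have "\<dots> = (\<Sum>j<?L. (U * real_diag ?L ev) $$ (i, j) * adj U $$ (j, k))"
      by (rule mat_mult_entry[OF mult_carrier_mat[OF U(1) real_diag_carrier] adj_carrier[OF U(1)] ik(1,2)])
    also have "\<dots> = (\<Sum>j<?L. of_real (ev j) * (u j \<alpha> * cnj (u j \<beta>)))"
      using U(1) ik by (intro sum.cong refl) (simp add: UD u_def idx)
    finally show ?thesis .
  qed
  have sep: "w \<alpha> = 0"
    if w: "\<forall>j<?L. (\<Sum>\<alpha>\<in>mons n m. u j \<alpha> * w \<alpha>) = 0" and \<alpha>: "\<alpha> \<in> mons n m" for w \<alpha>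
  proof -
    obtain k where k: "k < ?L" "\<alpha> = ms ! k" using surj \<alpha> by blast
    have sum0: "(\<Sum>i<?L. U $$ (i, j) * w (ms ! i)) = 0" if "j < ?L" for j
    proof -
      have "(\<Sum>i<?L. U $$ (i, j) * w (ms ! i)) = (\<Sum>i<?L. u j (ms ! i) * w (ms ! i))"
        by (intro sum.cong refl) (simp add: u_def idx)
      also have "\<dots> = (\<Sum>\<alpha>\<in>mons n m. u j \<alpha> * w \<alpha>)" by (rule sum.reindex_bij_betw[OF bij])
      finally show ?thesis using w that by simp
    qed
    have UUik: "(\<Sum>j<?L. U $$ (i, j) * cnj (U $$ (k, j))) = (if i = k then 1 else 0)" if "i < ?L" for i
    proof -
      have "(U * adj U) $$ (i, k) = (\<Sum>j<?L. U $$ (i, j) * cnj (U $$ (k, j)))"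
        using mat_mult_entry[OF U(1) adj_carrier[OF U(1)] that k(1)] U(1) k by simp
      then show ?thesis unfolding UU using k that by simp
    qed
    have "w \<alpha> = (\<Sum>i<?L. if i = k then w (ms ! i) else 0)" using k by simp
    also have "\<dots> = (\<Sum>i<?L. \<Sum>j<?L. U $$ (i, j) * cnj (U $$ (k, j)) * w (ms ! i))"
      unfolding sum_distrib_right[symmetric] by (intro sum.cong refl) (simp add: UUik)
    also have "\<dots> = (\<Sum>j<?L. cnj (U $$ (k, j)) * (\<Sum>i<?L. U $$ (i, j) * w (ms ! i)))"
      unfolding sum_distrib_left by (subst sum.swap) (simp add: mult_ac)
    also have "\<dots> = 0" by (simp add: sum0)
    finally show ?thesis .
  qed
  show ?thesis
  proof (rule that[OF P N])
    show "w \<alpha> = 0" if "\<forall>j<?L. (\<Sum>\<alpha>\<in>mons n m. u j \<alpha> * w \<alpha>) = 0" "\<alpha> \<in> mons n m" for w \<alpha>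
      by (rule sep[OF that])
  qed (rule c)
qed

section \<open>The signature bound\<close>

lemma squared_norm_bound:
  assumes n: "n \<ge> 1" and m: "m \<ge> 1"
    and herm: "hermitian_coeffs n m c" and sig: "signature_pair n m c = (P, N)"
    and sq: "is_squared_norm n
      (\<lambda>z. bihom_poly n m c z (conjugate z) * complex_of_real (sq_norm_cvec n z ^ d))"
  shows "D n (m + d) \<le> macaulay_iter m d (D n m - (P + N)) + P * D n d"
proof -
  let ?L = "D n m"
  obtain ev u where P: "P = card {j. j < ?L \<and> 0 < ev j}" and N: "N = card {j. j < ?L \<and> ev j < 0}"
    and c: "\<And>\<alpha> \<beta>. \<alpha> \<in> mons n m \<Longrightarrow> \<beta> \<in> mons n m \<Longrightarrow>
      c \<alpha> \<beta> = (\<Sum>j<?L. of_real (ev j) * (u j \<alpha> * cnj (u j \<beta>)))"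
    and sep: "\<And>w \<alpha>. (\<forall>j<?L. (\<Sum>\<alpha>\<in>mons n m. u j \<alpha> * w \<alpha>) = 0) \<Longrightarrow> \<alpha> \<in> mons n m \<Longrightarrow> w \<alpha> = 0"
    by (rule hermitian_coeffs_decomposition[OF n herm sig]) blast
  let ?pos = "{j. j < ?L \<and> 0 < ev j}" and ?neg = "{j. j < ?L \<and> ev j < 0}"
    and ?zero = "{j. j < ?L \<and> ev j = 0}"
  have "card {..<?L} = card (?pos \<union> ?neg \<union> ?zero)" by (rule arg_cong[where f = card]) auto
  also have "\<dots> = P + N + card ?zero"
    unfolding P N by (subst card_Un_disjoint; (subst card_Un_disjoint)?; auto)
  \<comment> \<open>The counts also give \<open>P + N \<le> D n m\<close>, so the subtraction is
    exact and the forms with eigenvalue 0 number H(m).\<close>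
  finally have Z: "card ?zero = D n m - (P + N)" by simp
  have r: "bihom_poly n m c z (conjugate z) =
      complex_of_real (\<Sum>j<?L. ev j * (cmod (\<Sum>\<alpha>\<in>mons n m. u j \<alpha> * monomial_eval z \<alpha>))\<^sup>2)"
    if z: "z \<in> carrier_vec n" for z
  proof -
    have "bihom_poly n m c z (conjugate z) = (\<Sum>\<alpha>\<in>mons n m. \<Sum>\<beta>\<in>mons n m.
        (\<Sum>j<?L. of_real (ev j) * (u j \<alpha> * cnj (u j \<beta>)) * monomial_eval z \<alpha> * cnj (monomial_eval z \<beta>)))"
      unfolding bihom_poly_def set_multi_indices
      by (intro sum.cong refl)
        (simp add: c monomial_eval_conjugate[OF z] sum_distrib_right del: complex_cnj_mult)
    also have "\<dots> = (\<Sum>j<?L. of_real (ev j) * (\<Sum>\<alpha>\<in>mons n m. \<Sum>\<beta>\<in>mons n m.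
        u j \<alpha> * cnj (u j \<beta>) * monomial_eval z \<alpha> * cnj (monomial_eval z \<beta>)))"
      unfolding sum_distrib_left
      by (subst (2) sum.swap, subst sum.swap) (simp add: mult.assoc)
    also have "\<dots> = (\<Sum>j<?L. of_real (ev j) *
        complex_of_real ((cmod (\<Sum>\<alpha>\<in>mons n m. u j \<alpha> * monomial_eval z \<alpha>))\<^sup>2))"
      unfolding cmod_square_sum ..
    finally show ?thesis by simp
  qed
  obtain \<mu> :: "nat list \<Rightarrow> real" where \<mu>: "\<forall>\<gamma>\<in>mons n d. \<mu> \<gamma> > 0"
    "\<forall>z\<in>carrier_vec n. sq_norm_cvec n z ^ d = (\<Sum>\<gamma>\<in>mons n d. \<mu> \<gamma> * (cmod (monomial_eval z \<gamma>))\<^sup>2)"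
    using sq_norm_power_expansion[of n d] by (elim exE conjE)
  have "card (mons n (m + d)) \<le> macaulay_iter m d (card ?zero) + card ?pos * card (mons n d)"
  proof (rule generators_bound[OF m, where E = "?pos \<union> ?neg" and u = u])
    fix w \<alpha> assume w: "\<forall>j\<in>?pos \<union> ?neg \<union> ?zero. (\<Sum>\<alpha>\<in>mons n m. u j \<alpha> * w \<alpha>) = 0"
      and \<alpha>: "\<alpha> \<in> mons n m"
    have "j \<in> ?pos \<union> ?neg \<union> ?zero" if "j < ?L" for j using that by auto
    then show "w \<alpha> = 0" using w by (intro sep[OF _ \<alpha>]) blast
  next
    fix w j \<gamma>
    let ?q = "\<lambda>j \<gamma>. \<Sum>\<delta>\<in>mons n (m + d). shifted n m (u j) \<gamma> \<delta> * w \<delta>"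
    assume pos: "\<forall>j\<in>?pos. \<forall>\<gamma>\<in>mons n d. ?q j \<gamma> = 0"
      and j: "j \<in> ?pos \<union> ?neg" and \<gamma>: "\<gamma> \<in> mons n d"
    show "?q j \<gamma> = 0"
    proof (cases "j \<in> ?pos")
      case False
      let ?t = "\<lambda>p. ev (fst p) * \<mu> (snd p) * (cmod (?q (fst p) (snd p)))\<^sup>2"
      let ?I = "{..<?L} \<times> mons n d"
      \<comment> \<open>Terms with positive eigenvalue vanish by \<open>pos\<close>; the others
        carry a nonpositive eigenvalue and a positive weight.\<close>
      have nonpos: "?t p \<le> 0" if p: "p \<in> ?I" for p
      proof (cases "fst p \<in> ?pos")
        case True
        then show ?thesis using pos p by (auto simp: mem_Times_iff)
      next
        case False
        then have "ev (fst p) \<le> 0" "0 \<le> \<mu> (snd p)" using p \<mu>(1) by (force simp: mem_Times_iff)+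
        then show ?thesis by (intro mult_nonpos_nonneg) simp_all
      qed
      have "0 \<le> (\<Sum>j<?L. \<Sum>\<gamma>\<in>mons n d. ev j * \<mu> \<gamma> * (cmod (?q j \<gamma>))\<^sup>2)"
        by (rule squared_norm_pairing_nonneg[OF finite_lessThan r \<mu>(2)[rule_format] sq])
      also have "\<dots> = (\<Sum>p\<in>?I. ?t p)"
        unfolding sum.cartesian_product by (simp add: case_prod_unfold)
      finally have "(\<Sum>p\<in>?I. - ?t p) \<le> 0" by (simp add: sum_negf)
      moreover have "(\<Sum>p\<in>?I. - ?t p) \<ge> 0" using nonpos by (intro sum_nonneg) simp
      ultimately have "(\<Sum>p\<in>?I. - ?t p) = 0" by simp
      moreover have "finite ?I" by (intro finite_cartesian_product finite_mons finite_lessThan)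
      ultimately have "\<forall>p\<in>?I. - ?t p = 0"
        using nonpos by (subst (asm) sum_nonneg_eq_0_iff) auto
      moreover have "(j, \<gamma>) \<in> ?I" using j \<gamma> by auto
      \<comment> \<open>A nonnegative sum of nonpositive terms has only zero terms; for a negative
        eigenvalue this kills the pairing itself.\<close>
      ultimately have "- ?t (j, \<gamma>) = 0" by blast
      moreover have "ev j < 0" "\<mu> \<gamma> > 0" using False j \<mu>(1) \<gamma> by auto
      ultimately show ?thesis by simp
    qed (use pos \<gamma> in blast)
  qed simp_all
  then show ?thesis using n by (simp only: card_mons Z P[symmetric])
qed

theorem theorem2:
  fixes n m d P N R H :: nat
    and c :: "nat list \<Rightarrow> nat list \<Rightarrow> complex"
  assumes "n \<ge> 1" and "m \<ge> 1"
    and "hermitian_coeffs n m c"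
    and "signature_pair n m c = (P, N)"
    and "R = P + N"
    and "H = D n m - R"
  shows "(is_squared_norm n
            (\<lambda>z. bihom_poly n m c z (conjugate z) * complex_of_real (sq_norm_cvec n z ^ d)) \<longrightarrow>
          real P \<ge> (real (D n (m + d)) - real (macaulay_iter m d H)) / real (D n d))
       \<and> (\<forall>J k. macaulay_rep m H J k \<longrightarrow>
            (real P \<ge> (real (D n (m + d)) - real (macaulay_iter m d H)) / real (D n d)
             \<longleftrightarrow> real P \<ge> (real (D n (m + d)) - real (\<Sum>j=J..m. (k j + d) choose (j + d)))
                            / real (D n d)))"
proof (intro conjI impI allI)
  assume "is_squared_norm n
    (\<lambda>z. bihom_poly n m c z (conjugate z) * complex_of_real (sq_norm_cvec n z ^ d))"
  from squared_norm_bound[OF assms(1-4) this]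
  have "D n (m + d) \<le> macaulay_iter m d H + P * D n d" by (simp add: assms(5,6))
  then have "real (D n (m + d)) \<le> real (macaulay_iter m d H) + real P * real (D n d)"
    by (simp only: of_nat_le_iff of_nat_add[symmetric] of_nat_mult[symmetric])
  moreover have "0 < D n d" using assms(1) by (simp add: D_def)
  ultimately show "real P \<ge> (real (D n (m + d)) - real (macaulay_iter m d H)) / real (D n d)"
    by (simp add: pos_divide_le_eq)
next
  fix J k assume "macaulay_rep m H J k"
  from macaulay_iter_eq[OF this, of d]
  show "real P \<ge> (real (D n (m + d)) - real (macaulay_iter m d H)) / real (D n d)
      \<longleftrightarrow> real P \<ge> (real (D n (m + d)) - real (\<Sum>j=J..m. (k j + d) choose (j + d))) / real (D n d)"
    by (simp only:)
qed

end
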